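(* There is $\beta=\beta(n,\alpha_0)>0$ such that every hypersurface in $\mathcal C_{\tau,\kappa}(R,\alpha)$, $\alpha=(\alpha_0,\alpha_1,\alpha_2)$, satisfies $$\lambda_1+\lambda_2\geq\beta H .$$ One may take $$\beta=\frac{2\alpha_0}{2(n-2)+n\alpha_0}.$$ Consequently, $$-H\leq\lambda_1\leq\cdots\leq\lambda_n\leq H,\qquad \frac1nH^2\leq|A|^2\leq nH^2,$$ $\lambda_i\geq\beta H/2$ for $i\geq 2$, and $$|H\nabla_ih_{kl}-(\nabla_iH)h_{kl}|^2\geq\frac{\beta^2}{8}H^2|\nabla H|^2 .$$
   Context: Let $n\geq3$, $0\leq\kappa\leq1$, and let $\mathbb H^{n+1}_\kappa$ be the simply connected space form of constant sectional curvature $-\kappa^2$ (Euclidean if $\kappa=0$). For a two-sided immersion with unit normal $\nu$: $h_{ij}=\bar g(\bar\nabla_{\partial_i}\nu,\partial_j)$, $A=(h_i{}^j)$ is the Weingarten map with eigenvalues $\lambda_1\leq\cdots\leq\lambda_n$, $H=\operatorname{tr}A$, $|A|^2=\sum_i\lambda_i^2$, and $\nabla$ is the Levi-Civita connection of the induced metric. Put $$P_{ij}^{(\tau)}=H(\lambda_i+\lambda_j)-\lambda_i^2-\lambda_j^2-\tau\lambda_i\lambda_j-(2(n-1)-\tau)\kappa^2\quad(i\neq j).$$ Let $\mathcal I_3=[0,2)$ and $\mathcal I_n=[0,2]$ for $n\geq4$. For $\tau\in\mathcal I_n$, $0<R\leq1$ and positive constants $\alpha=(\alpha_0,\alpha_1,\alpha_2)$,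 the class $\mathcal C_{\tau,\kappa}(R,\alpha)$ consists of smooth closed two-sided hypersurface immersions $X:M^n\to\mathbb H^{n+1}_\kappa$ (with chosen normal) such that (i) $P_{ij}^{(\tau)}\geq\alpha_0H|\lambda_p-\lambda_q|$ for all $i\neq j$ and all $p,q$; (ii) $H-n\kappa\geq\alpha_2R^{-1}$; (iii) the induced area satisfies $|M|\leq\alpha_1R^n$. *)

theory Defs
  imports "HOL-Analysis.Analysis" "HOL-Computational_Algebra.Polynomial"
begin

section \<open>Smooth maps between Euclidean spaces\<close>

fun Ck_on :: "nat \<Rightarrow> 'a::real_normed_vector set \<Rightarrow> ('a \<Rightarrow> 'b::real_normed_vector) \<Rightarrow> bool" where
  "Ck_on 0 S f \<longleftrightarrow> continuous_on S f"
| "Ck_on (Suc k) S f \<longleftrightarrow>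
     (\<forall>x\<in>S. f differentiable (at x)) \<and> (\<forall>v. Ck_on k S (\<lambda>x. frechet_derivative f (at x) v))"

text \<open>Only used for open sets \<open>S\<close> in finite-dimensional spaces.\<close>

definition smooth_on :: "'a::real_normed_vector set \<Rightarrow> ('a \<Rightarrow> 'b::real_normed_vector) \<Rightarrow> bool" where
  "smooth_on S f \<longleftrightarrow> (\<forall>k. Ck_on k S f)"

definition pd :: "'n::finite \<Rightarrow> (real^'n \<Rightarrow> 'b::real_normed_vector) \<Rightarrow> real^'n \<Rightarrow> 'b" where
  "pd i f x = frechet_derivative f (at x) (axis i 1)"


section \<open>Riemannian metrics on open subsets of Euclidean space\<close>

text \<open>A metric is given by its coefficient matrix \<open>G x $ i $ j\<close> in the standard coordinates.\<close>

definition metric_ip :: "(real^'k \<Rightarrow> real^'k^'k) \<Rightarrow> real^'k \<Rightarrow> real^'k \<Rightarrow> real^'k::finite \<Rightarrow> real" where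
  "metric_ip G y u v = (\<Sum>a\<in>UNIV. \<Sum>b\<in>UNIV. G y $ a $ b * u $ a * v $ b)"

text \<open>\<open>christoffel G x i j k\<close> has lower indices \<open>i\<close>, \<open>j\<close> and upper index \<open>k\<close>.\<close>

definition christoffel ::
  "(real^'k \<Rightarrow> real^'k^'k) \<Rightarrow> real^'k \<Rightarrow> 'k::finite \<Rightarrow> 'k \<Rightarrow> 'k \<Rightarrow> real" where
  "christoffel G x i j k =
     (1/2) * (\<Sum>l\<in>UNIV. matrix_inv (G x) $ k $ l *
       (pd i (\<lambda>y. G y $ j $ l) x + pd j (\<lambda>y. G y $ i $ l) x - pd l (\<lambda>y. G y $ i $ j) x))"

text \<open>
  The simply connected space form of curvature \<open>-\<kappa>\<^sup>2\<close>, \<open>\<kappa> \<ge> 0\<close>, in its conformal ball model: the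
  metric \<open>\<bar>dy\<bar>\<^sup>2 / (1 - \<kappa>\<^sup>2\<bar>y\<bar>\<^sup>2/4)\<^sup>2\<close> on the ball of radius \<open>2/\<kappa>\<close>, which is the
  Euclidean metric on the whole space if \<open>\<kappa> = 0\<close>.
\<close>

definition sf_domain :: "real \<Rightarrow> (real^'k::finite) set" where
  "sf_domain \<kappa> = {y. \<kappa>\<^sup>2 * (norm y)\<^sup>2 < 4}"

definition sf_metric :: "real \<Rightarrow> real^'k \<Rightarrow> real^'k^'k::finite" where
  "sf_metric \<kappa> y = (1 / (1 - \<kappa>\<^sup>2 * (norm y)\<^sup>2 / 4)\<^sup>2) *\<^sub>R mat 1"


section \<open>Local geometry of a parametrised hypersurface\<close>

text \<open>
  Below \<open>G\<close> is the ambient metric, \<open>F\<close> a local parametrisation of the hypersurface and \<open>N\<close>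
  a unit normal field along \<open>F\<close>.
\<close>

definition induced_metric ::
  "(real^'k \<Rightarrow> real^'k^'k) \<Rightarrow> (real^'n \<Rightarrow> real^'k) \<Rightarrow> real^'n \<Rightarrow> real^'n::finite^'n::finite" where
  "induced_metric G F x = (\<chi> i j. metric_ip G (F x) (pd i F x) (pd j F x))"

text \<open>The ambient covariant derivative of the vector field \<open>N\<close> along \<open>F\<close> in direction \<open>\<partial>\<^sub>i\<close>.\<close>

definition cov_along ::
  "(real^'k \<Rightarrow> real^'k^'k) \<Rightarrow> (real^'n \<Rightarrow> real^'k) \<Rightarrow> (real^'n \<Rightarrow> real^'k) \<Rightarrow> 'n \<Rightarrow> real^'n::finite
     \<Rightarrow> real^'k::finite" where
  "cov_along G F N i x =
     pd i N x + (\<chi> c. \<Sum>a\<in>UNIV. \<Sum>b\<in>UNIV. christoffel G (F x) a b c * pd i F x $ a * N x $ b)"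

definition second_ff ::
  "(real^'k::finite \<Rightarrow> real^'k^'k) \<Rightarrow> (real^'n \<Rightarrow> real^'k) \<Rightarrow> (real^'n \<Rightarrow> real^'k) \<Rightarrow> real^'n
     \<Rightarrow> real^'n::finite^'n::finite" where
  "second_ff G F N x = (\<chi> i j. metric_ip G (F x) (cov_along G F N i x) (pd j F x))"

text \<open>The entry at \<open>$ i $ j\<close> is \<open>h\<^sub>i\<^sup>j = \<Sum>\<^sub>k h\<^sub>i\<^sub>k g\<^sup>k\<^sup>j\<close>.\<close>

definition weingarten ::
  "(real^'k::finite \<Rightarrow> real^'k^'k) \<Rightarrow> (real^'n \<Rightarrow> real^'k) \<Rightarrow> (real^'n \<Rightarrow> real^'k) \<Rightarrow> real^'n
     \<Rightarrow> real^'n::finite^'n::finite" where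
  "weingarten G F N x = second_ff G F N x ** matrix_inv (induced_metric G F x)"

definition charpoly :: "real^'n^'n::finite \<Rightarrow> real poly" where
  "charpoly B = det (mat [:0, 1:] - (\<chi> i j. [:B $ i $ j:]))"

text \<open>The real eigenvalues with algebraic multiplicity, in non-decreasing order.\<close>

definition eigenvalue_list :: "real^'n^'n::finite \<Rightarrow> real list" where
  "eigenvalue_list B = sorted_list_of_multiset (proots (charpoly B))"

text \<open>The principal curvatures, indexed by \<open>1, \<dots>, n\<close>.\<close>

definition pcurv ::
  "(real^'k::finite \<Rightarrow> real^'k^'k) \<Rightarrow> (real^'n::finite \<Rightarrow> real^'k) \<Rightarrow> (real^'n \<Rightarrow> real^'k) \<Rightarrow> real^'n
     \<Rightarrow> nat \<Rightarrow> real" where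
  "pcurv G F N x i = eigenvalue_list (weingarten G F N x) ! (i - 1)"

definition mean_curv ::
  "(real^'k::finite \<Rightarrow> real^'k^'k) \<Rightarrow> (real^'n::finite \<Rightarrow> real^'k) \<Rightarrow> (real^'n \<Rightarrow> real^'k) \<Rightarrow> real^'n
     \<Rightarrow> real" where
  "mean_curv G F N x = trace (weingarten G F N x)"

definition normA_sq ::
  "(real^'k::finite \<Rightarrow> real^'k^'k) \<Rightarrow> (real^'n::finite \<Rightarrow> real^'k) \<Rightarrow> (real^'n \<Rightarrow> real^'k) \<Rightarrow> real^'n
     \<Rightarrow> real" where
  "normA_sq G F N x = (\<Sum>i=1..CARD('n). (pcurv G F N x i)\<^sup>2)"

text \<open>\<open>nabla_h G F N x i k l\<close> is \<open>\<nabla>\<^sub>i h\<^sub>k\<^sub>l\<close> for the Levi-Civita connection of the induced metric.\<close>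

definition nabla_h ::
  "(real^'k::finite \<Rightarrow> real^'k^'k) \<Rightarrow> (real^'n::finite \<Rightarrow> real^'k) \<Rightarrow> (real^'n \<Rightarrow> real^'k) \<Rightarrow> real^'n
     \<Rightarrow> 'n \<Rightarrow> 'n \<Rightarrow> 'n \<Rightarrow> real" where
  "nabla_h G F N x i k l =
     pd i (\<lambda>y. second_ff G F N y $ k $ l) x
     - (\<Sum>m\<in>UNIV. christoffel (induced_metric G F) x i k m * second_ff G F N x $ m $ l)
     - (\<Sum>m\<in>UNIV. christoffel (induced_metric G F) x i l m * second_ff G F N x $ k $ m)"

text \<open>Squared norms of covariant 1- and 3-tensors with respect to a metric with matrix \<open>g\<close>.\<close>

definition tensor1_norm_sq :: "real^'n^'n::finite \<Rightarrow> ('n \<Rightarrow> real) \<Rightarrow> real" where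
  "tensor1_norm_sq g T =
     (\<Sum>i\<in>UNIV. \<Sum>a\<in>UNIV. matrix_inv g $ i $ a * T i * T a)"

definition tensor3_norm_sq :: "real^'n^'n::finite \<Rightarrow> ('n \<Rightarrow> 'n \<Rightarrow> 'n \<Rightarrow> real) \<Rightarrow> real" where
  "tensor3_norm_sq g T =
     (\<Sum>i\<in>UNIV. \<Sum>k\<in>UNIV. \<Sum>l\<in>UNIV. \<Sum>a\<in>UNIV. \<Sum>b\<in>UNIV. \<Sum>c\<in>UNIV.
        matrix_inv g $ i $ a * matrix_inv g $ k $ b * matrix_inv g $ l $ c * T i k l * T a b c)"


section \<open>Closed manifolds and immersed hypersurfaces\<close>

text \<open>A chart is a pair of its domain and its coordinate map (relevant on the domain only).\<close>

type_synonym ('m, 'n) chart = "'m set \<times> ('m \<Rightarrow> real^'n)"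

definition chart_range :: "('m, 'n::finite) chart \<Rightarrow> (real^'n) set" where
  "chart_range c = snd c ` fst c"

definition in_chart :: "('m, 'n::finite) chart \<Rightarrow> ('m \<Rightarrow> 'b) \<Rightarrow> real^'n \<Rightarrow> 'b" where
  "in_chart c f = (\<lambda>x. f (inv_into (fst c) (snd c) x))"

text \<open>
  A closed smooth manifold of dimension \<open>CARD('n)\<close>: \<open>\<A>\<close> is a smooth atlas, not necessarily maximal.
  Second countability follows from compactness; there is no boundary as chart ranges are open
  in \<open>real^'n\<close>. Connectedness is not required.
\<close>

definition closed_manifold :: "'m topology \<Rightarrow> ('m, 'n::finite) chart set \<Rightarrow> bool" where
  "closed_manifold M \<A> \<longleftrightarrow>
     Hausdorff_space M \<and> compact_space M \<and>
     (\<Union>c\<in>\<A>. fst c) = topspace M \<and>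
     (\<forall>c\<in>\<A>. openin M (fst c) \<and> open (chart_range c) \<and>
        homeomorphic_map (subtopology M (fst c)) (top_of_set (chart_range c)) (snd c)) \<and>
     (\<forall>c\<in>\<A>. \<forall>d\<in>\<A>. smooth_on (snd c ` (fst c \<inter> fst d)) (in_chart c (snd d)))"

text \<open>
  \<open>X\<close> is an immersion into the open set \<open>\<Omega>\<close> with metric \<open>G\<close>, and the globally defined \<open>\<nu>\<close> is a
  smooth unit normal field along \<open>X\<close>.
\<close>

definition two_sided_immersion ::
  "(real^'k) set \<Rightarrow> (real^'k \<Rightarrow> real^'k^'k) \<Rightarrow> 'm topology \<Rightarrow> ('m, 'n::finite) chart set
     \<Rightarrow> ('m \<Rightarrow> real^'k::finite) \<Rightarrow> ('m \<Rightarrow> real^'k) \<Rightarrow> bool" where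
  "two_sided_immersion \<Omega> G M \<A> X \<nu> \<longleftrightarrow>
     CARD('k) = CARD('n) + 1 \<and>
     X ` topspace M \<subseteq> \<Omega> \<and>
     (\<forall>c\<in>\<A>. smooth_on (chart_range c) (in_chart c X) \<and>
             smooth_on (chart_range c) (in_chart c \<nu>)) \<and>
     (\<forall>c\<in>\<A>. \<forall>x\<in>chart_range c.
        inj (frechet_derivative (in_chart c X) (at x)) \<and>
        metric_ip G (in_chart c X x) (in_chart c \<nu> x) (in_chart c \<nu> x) = 1 \<and>
        (\<forall>i. metric_ip G (in_chart c X x) (in_chart c \<nu> x) (pd i (in_chart c X) x) = 0))"

text \<open>
  The total area of the induced metric. By additivity of the Riemannian measure the supremum over
  finite disjoint families of Borel sets \<open>K i\<close>, each inside the domain of a chart \<open>c i\<close>, is attained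
  by every finite Borel partition of \<open>M\<close> subordinate to the atlas.
\<close>

definition area ::
  "(real^'k::finite \<Rightarrow> real^'k^'k) \<Rightarrow> ('m, 'n::finite) chart set \<Rightarrow> ('m \<Rightarrow> real^'k) \<Rightarrow> ennreal" where
  "area G \<A> X = Sup {s. \<exists>(m::nat) (c :: nat \<Rightarrow> ('m, 'n) chart) K.
      (\<forall>i<m. c i \<in> \<A> \<and> K i \<subseteq> fst (c i) \<and> snd (c i) ` K i \<in> sets borel) \<and>
      disjoint_family_on K {..<m} \<and>
      s = (\<Sum>i<m. \<integral>\<^sup>+x\<in>snd (c i) ` K i.
             ennreal (sqrt (det (induced_metric G (in_chart (c i) X) x))) \<partial>lborel)}"


section \<open>The curvature class\<close>

definition tau_range :: "nat \<Rightarrow> real set" where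
  "tau_range n = (if n = 3 then {0..<2} else {0..2})"

text \<open>\<open>H\<close> and \<open>l\<close> stand for the mean curvature and the principal curvatures at a point.\<close>

definition P_tau :: "nat \<Rightarrow> real \<Rightarrow> real \<Rightarrow> real \<Rightarrow> (nat \<Rightarrow> real) \<Rightarrow> nat \<Rightarrow> nat \<Rightarrow> real" where
  "P_tau n \<kappa> \<tau> H l i j =
     H * (l i + l j) - (l i)\<^sup>2 - (l j)\<^sup>2 - \<tau> * l i * l j - (2 * (real n - 1) - \<tau>) * \<kappa>\<^sup>2"

text \<open>
  The pointwise conditions involve only coordinate-invariant quantities, so requiring them in
  all charts around a point is the same as requiring them in one.
\<close>

definition curvature_class ::
  "real \<Rightarrow> real \<Rightarrow> real \<Rightarrow> real \<Rightarrow> real \<Rightarrow> real \<Rightarrow> 'm topology \<Rightarrow> ('m, 'n::finite) chart set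
     \<Rightarrow> ('m \<Rightarrow> real^'k::finite) \<Rightarrow> ('m \<Rightarrow> real^'k) \<Rightarrow> bool" where
  "curvature_class \<tau> \<kappa> R \<alpha>\<^sub>0 \<alpha>\<^sub>1 \<alpha>\<^sub>2 M \<A> X \<nu> \<longleftrightarrow>
     closed_manifold M \<A> \<and>
     two_sided_immersion (sf_domain \<kappa>) (sf_metric \<kappa>) M \<A> X \<nu> \<and>
     (\<forall>c\<in>\<A>. \<forall>x\<in>chart_range c.
        let H = mean_curv (sf_metric \<kappa>) (in_chart c X) (in_chart c \<nu>) x;
            l = pcurv (sf_metric \<kappa>) (in_chart c X) (in_chart c \<nu>) x;
            n = CARD('n)
        in (\<forall>i\<in>{1..n}. \<forall>j\<in>{1..n}. i \<noteq> j \<longrightarrow>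
              (\<forall>p\<in>{1..n}. \<forall>q\<in>{1..n}. P_tau n \<kappa> \<tau> H l i j \<ge> \<alpha>\<^sub>0 * H * \<bar>l p - l q\<bar>)) \<and>
           H - real n * \<kappa> \<ge> \<alpha>\<^sub>2 / R) \<and>
     area (sf_metric \<kappa>) \<A> X \<le> ennreal (\<alpha>\<^sub>1 * R ^ CARD('n))"

end

theory Submission
  imports Defs
begin

text \<open>
  Fix a point and write \<open>\<lambda>\<^sub>1 \<le> \<dots> \<le> \<lambda>\<^sub>n\<close> for the principal curvatures there. The class forces \<open>H > 0\<close>.
  The eigenvalue estimates are elementary consequences of the pinching condition for the pair
  \<open>(1, 2)\<close>. It bounds \<open>\<alpha>\<^sub>0 (\<lambda>\<^sub>n - \<lambda>\<^sub>1)\<close> by \<open>\<lambda>\<^sub>1 + \<lambda>\<^sub>2\<close>, since the quadratic terms subtracted in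
  \<open>P\<^sub>1\<^sub>2\<close> are nonnegative; so all principal curvatures, and with them \<open>H\<close>, are bounded by a multiple
  of \<open>\<lambda>\<^sub>1 + \<lambda>\<^sub>2\<close> (\<open>two_smallest_bound\<close>). In particular \<open>\<lambda>\<^sub>i \<ge> \<beta>H/2\<close> for \<open>i \<ge> 2\<close>, and the other bounds
  follow (\<open>eigenvalue_bounds\<close>).

  The gradient estimate rests on the Codazzi equation \<open>\<nabla>\<^sub>ih\<^sub>k\<^sub>l = \<nabla>\<^sub>kh\<^sub>i\<^sub>l\<close>. Antisymmetrising
  \<open>H\<nabla>\<^sub>ih\<^sub>k\<^sub>l - (\<nabla>\<^sub>iH)h\<^sub>k\<^sub>l\<close> in \<open>i\<close> and \<open>k\<close> removes \<open>\<nabla>h\<close> and leaves \<open>(\<nabla>\<^sub>kH)h\<^sub>i\<^sub>l - (\<nabla>\<^sub>iH)h\<^sub>k\<^sub>l\<close>.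
  In a frame of principal directions its components with \<open>l = k \<noteq> i\<close> are \<open>-(\<nabla>\<^sub>iH)\<lambda>\<^sub>k\<close>, and for every
  \<open>i\<close> there is such a \<open>k\<close> with \<open>\<lambda>\<^sub>k \<ge> \<beta>H/2\<close>, because \<open>n \<ge> 3\<close> and at most \<open>\<lambda>\<^sub>1\<close> is smaller
  (\<open>codazzi_gradient_bound\<close>).

  Two pieces of theory support this. The Codazzi equation (\<open>codazzi\<close>) is derived in the conformal ball
  model: \<open>\<nabla>\<^sub>ih\<^sub>k\<^sub>l\<close> equals \<open>\<langle>D\<^sub>iD\<^sub>kN, \<partial>\<^sub>lF\<rangle>\<close>, up to a term symmetric in \<open>i\<close> and \<open>k\<close>, and the
  derivatives \<open>D\<^sub>i\<close>, \<open>D\<^sub>k\<close> commute on the normal \<open>N\<close> because the ambient curvature is constant. The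
  frame of principal directions comes from diagonalising the first and the second fundamental
  form simultaneously (\<open>simultaneous_diagonalization\<close>). It identifies the sorted roots of the
  characteristic polynomial of the Weingarten map and writes the tensor norms as sums of squares.
\<close>

section \<open>Symmetry of second derivatives\<close>

text \<open>
  The left-hand side of the conclusion is symmetric in \<open>u\<close> and \<open>v\<close>. Applying the mean value
  theorem first along \<open>u\<close> and then along \<open>v\<close>, or the other way round, therefore compares the two
  mixed derivatives at nearby points.
\<close>

lemma second_difference_mvt:
  fixes f :: "'a::real_normed_vector \<Rightarrow> real"
  assumes h: "h > 0"
    and S: "\<And>s t. \<lbrakk>0 \<le> s; s \<le> h; 0 \<le> t; t \<le> h\<rbrakk> \<Longrightarrow> x + s *\<^sub>R u + t *\<^sub>R v \<in> S"
    and f: "\<And>y. y \<in> S \<Longrightarrow> (f has_derivative f' y) (at y)"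
    and Du: "\<And>y. y \<in> S \<Longrightarrow> ((\<lambda>z. f' z u) has_derivative Du y) (at y)"
  obtains a b where "0 < a" "a < h" "0 < b" "b < h"
    "f (x + h *\<^sub>R u + h *\<^sub>R v) - f (x + h *\<^sub>R u) - f (x + h *\<^sub>R v) + f x
       = h * h * Du (x + a *\<^sub>R u + b *\<^sub>R v) v"
proof -
  let ?g = "\<lambda>s. f (x + s *\<^sub>R u + h *\<^sub>R v) - f (x + s *\<^sub>R u)"
  have S0: "x + s *\<^sub>R u \<in> S" if "0 \<le> s" "s \<le> h" for s
    using S[of s 0] that h by simp
  have line: "((\<lambda>s. f (x + s *\<^sub>R u + c)) has_derivative (\<lambda>r. f' (x + s *\<^sub>R u + c) (r *\<^sub>R u))) (at s)"
    if "x + s *\<^sub>R u + c \<in> S" for s c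
    using that by (intro has_derivative_compose[where f="\<lambda>s. x + s *\<^sub>R u + c" and g=f] f)
      (auto intro!: derivative_eq_intros)
  have "\<exists>a\<in>{0<..<h}. ?g h - ?g 0
      = f' (x + a *\<^sub>R u + h *\<^sub>R v) ((h - 0) *\<^sub>R u) - f' (x + a *\<^sub>R u) ((h - 0) *\<^sub>R u)"
  proof (rule mvt_simple[OF h, of ?g])
    fix s assume s: "0 \<le> s" "s \<le> h"
    have "(?g has_derivative
        (\<lambda>r. f' (x + s *\<^sub>R u + h *\<^sub>R v) (r *\<^sub>R u) - f' (x + s *\<^sub>R u) (r *\<^sub>R u))) (at s)"
      using line[of s "h *\<^sub>R v"] line[of s 0] S[of s h] S0[of s] s h
      by (intro has_derivative_diff) auto
    then show "(?g has_derivative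
        (\<lambda>r. f' (x + s *\<^sub>R u + h *\<^sub>R v) (r *\<^sub>R u) - f' (x + s *\<^sub>R u) (r *\<^sub>R u))) (at s within {0..h})"
      by (rule has_derivative_at_withinI)
  qed
  then obtain a where a: "0 < a" "a < h" and
    ga: "?g h - ?g 0 = f' (x + a *\<^sub>R u + h *\<^sub>R v) (h *\<^sub>R u) - f' (x + a *\<^sub>R u) (h *\<^sub>R u)"
    by auto
  have lin: "f' y (h *\<^sub>R u) = h * f' y u" if "y \<in> S" for y
    using has_derivative_linear[OF f[OF that]] by (simp add: linear_cmul)
  let ?k = "\<lambda>t. f' (x + a *\<^sub>R u + t *\<^sub>R v) u"
  have line2: "(?k has_derivative (\<lambda>r. Du (x + a *\<^sub>R u + t *\<^sub>R v) (r *\<^sub>R v))) (at t)"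
    if "0 \<le> t" "t \<le> h" for t
    by (rule has_derivative_compose[where g="\<lambda>z. f' z u", OF _ Du])
       (use S a that in \<open>auto intro!: derivative_eq_intros\<close>)
  have "\<exists>b\<in>{0<..<h}. ?k h - ?k 0 = Du (x + a *\<^sub>R u + b *\<^sub>R v) ((h - 0) *\<^sub>R v)"
    by (rule mvt_simple[OF h, of ?k]) (auto intro: has_derivative_at_withinI line2)
  then obtain b where b: "0 < b" "b < h" and kb: "?k h - ?k 0 = Du (x + a *\<^sub>R u + b *\<^sub>R v) (h *\<^sub>R v)"
    by auto
  have "Du (x + a *\<^sub>R u + b *\<^sub>R v) (h *\<^sub>R v) = h * Du (x + a *\<^sub>R u + b *\<^sub>R v) v"
    using has_derivative_linear[OF Du[OF S[of a b]]] a b by (simp add: linear_cmul)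
  moreover have "?g h - ?g 0 = h * (?k h - ?k 0)"
    using ga lin[OF S[of a h]] lin[OF S0[of a]] a h by (simp add: algebra_simps)
  ultimately show ?thesis
    using that[OF a b] kb by (simp add: algebra_simps)
qed

text \<open>
  Schwarz's theorem. If the two mixed derivatives differed at \<open>x\<close>, then by continuity their values
  at any two points near \<open>x\<close> would differ; but a small second difference is \<open>h\<^sup>2\<close> times a nearby
  value of either of them.
\<close>

lemma mixed_derivatives_commute:
  fixes f :: "'a::real_normed_vector \<Rightarrow> real"
  assumes S: "open S" "x \<in> S"
    and f: "\<And>y. y \<in> S \<Longrightarrow> (f has_derivative f' y) (at y)"
    and Du: "\<And>y. y \<in> S \<Longrightarrow> ((\<lambda>z. f' z u) has_derivative Du y) (at y)"
    and Dv: "\<And>y. y \<in> S \<Longrightarrow> ((\<lambda>z. f' z v) has_derivative Dv y) (at y)"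
    and cu: "continuous_on S (\<lambda>y. Du y v)" and cv: "continuous_on S (\<lambda>y. Dv y u)"
  shows "Du x v = Dv x u"
proof (rule ccontr)
  assume ne: "Du x v \<noteq> Dv x u"
  define e where "e = \<bar>Du x v - Dv x u\<bar> / 2"
  have e: "e > 0" using ne by (simp add: e_def)
  obtain r where r: "r > 0" "ball x r \<subseteq> S" using S open_contains_ball by blast
  obtain d1 where d1: "d1 > 0" "\<And>y. \<lbrakk>y \<in> S; dist y x < d1\<rbrakk> \<Longrightarrow> dist (Du y v) (Du x v) < e"
    using cu S(2) e unfolding continuous_on_iff by metis
  obtain d2 where d2: "d2 > 0" "\<And>y. \<lbrakk>y \<in> S; dist y x < d2\<rbrakk> \<Longrightarrow> dist (Dv y u) (Dv x u) < e"
    using cv S(2) e unfolding continuous_on_iff by metis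
  define d where "d = min r (min d1 d2)"
  define h where "h = d / (norm u + norm v + 1)"
  have d: "d > 0" using r d1 d2 by (simp add: d_def)
  have pos: "norm u + norm v + 1 > 0" by (smt (verit) norm_ge_zero)
  have h: "h > 0" using d pos by (simp add: h_def)
  have "h * (norm u + norm v) < d"
    using d pos by (simp add: h_def field_simps)
  then have near: "dist (x + s *\<^sub>R u + t *\<^sub>R v) x < d" if "0 \<le> s" "s \<le> h" "0 \<le> t" "t \<le> h" for s t
  proof -
    have "norm (s *\<^sub>R u + t *\<^sub>R v) \<le> s * norm u + t * norm v"
      using norm_triangle_ineq[of "s *\<^sub>R u" "t *\<^sub>R v"] that by simp
    also have "\<dots> \<le> h * norm u + h * norm v"
      using that by (intro add_mono mult_right_mono) auto
    finally show ?thesis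
      using \<open>h * (norm u + norm v) < d\<close> by (simp add: dist_norm algebra_simps)
  qed
  have inS: "x + s *\<^sub>R u + t *\<^sub>R v \<in> S" if "0 \<le> s" "s \<le> h" "0 \<le> t" "t \<le> h" for s t
    using near[OF that] r by (auto simp: d_def dist_commute)
  obtain a b where ab: "0 < a" "a < h" "0 < b" "b < h" and
    1: "f (x + h *\<^sub>R u + h *\<^sub>R v) - f (x + h *\<^sub>R u) - f (x + h *\<^sub>R v) + f x
       = h * h * Du (x + a *\<^sub>R u + b *\<^sub>R v) v"
    using second_difference_mvt[OF h inS f Du] by blast
  have inS': "x + s *\<^sub>R v + t *\<^sub>R u \<in> S" if "0 \<le> s" "s \<le> h" "0 \<le> t" "t \<le> h" for s t
    using inS[of t s] that by (simp add: algebra_simps)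
  obtain a' b' where ab': "0 < a'" "a' < h" "0 < b'" "b' < h" and
    2: "f (x + h *\<^sub>R v + h *\<^sub>R u) - f (x + h *\<^sub>R v) - f (x + h *\<^sub>R u) + f x
       = h * h * Dv (x + a' *\<^sub>R v + b' *\<^sub>R u) u"
    using second_difference_mvt[OF h inS' f Dv] by blast
  let ?p = "x + a *\<^sub>R u + b *\<^sub>R v" and ?q = "x + b' *\<^sub>R u + a' *\<^sub>R v"
  have "h * h * Du ?p v = h * h * Dv ?q u"
    using 1 2 by (simp add: algebra_simps)
  then have "Du ?p v = Dv ?q u" using h by simp
  moreover have "dist (Du ?p v) (Du x v) < e"
    using d1(2)[OF inS near[THEN order.strict_trans2]] ab by (simp add: d_def)
  moreover have "dist (Dv ?q u) (Dv x u) < e"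
    using d2(2)[OF inS near[THEN order.strict_trans2]] ab' by (simp add: d_def)
  ultimately show False
    unfolding e_def dist_real_def by (auto simp: abs_if split: if_splits)
qed

section \<open>Partial derivatives of smooth maps\<close>

lemma pd_eqI: "(f has_derivative f') (at x) \<Longrightarrow> pd i f x = f' (axis i 1)"
  unfolding pd_def using frechet_derivative_at by metis

lemma pd_cong_open:
  assumes "open S" "x \<in> S" "\<And>y. y \<in> S \<Longrightarrow> f y = g y"
  shows "pd i f x = pd i g x"
proof -
  have "(f has_derivative D) (at x) \<longleftrightarrow> (g has_derivative D) (at x)" for D
    using has_derivative_transform_within_open[OF _ assms(1,2), of f D UNIV g]
      has_derivative_transform_within_open[OF _ assms(1,2), of g D UNIV f] assms(3) by auto
  then show ?thesis unfolding pd_def frechet_derivative_def by simp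
qed

lemma pd_const: "pd i (\<lambda>y. c) x = 0"
  by (simp add: pd_def)

lemma pd_add:
  assumes "f differentiable (at x)" "g differentiable (at x)"
  shows "pd i (\<lambda>y. f y + g y) x = pd i f x + pd i g x"
  using assms by (auto simp: pd_def[of _ f] pd_def[of _ g] frechet_derivative_works
      intro!: pd_eqI[THEN trans] derivative_eq_intros)

lemma pd_inner:
  fixes f g :: "real^'n::finite \<Rightarrow> 'b::real_inner"
  assumes "f differentiable (at x)" "g differentiable (at x)"
  shows "pd i (\<lambda>y. f y \<bullet> g y) x = pd i f x \<bullet> g x + f x \<bullet> pd i g x"
  using assms by (auto simp: pd_def[of _ f] pd_def[of _ g] frechet_derivative_works
      intro!: pd_eqI[THEN trans] derivative_eq_intros)

lemma pd_scaleR: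
  fixes g :: "real^'n::finite \<Rightarrow> 'b::real_normed_vector"
  assumes "f differentiable (at x)" "g differentiable (at x)"
  shows "pd i (\<lambda>y. f y *\<^sub>R g y) x = pd i f x *\<^sub>R g x + f x *\<^sub>R pd i g x"
  using assms by (auto simp: pd_def[of _ f] pd_def[of _ g] frechet_derivative_works add.commute
      intro!: pd_eqI[THEN trans] derivative_eq_intros)

lemma pd_mult:
  fixes f g :: "real^'n::finite \<Rightarrow> real"
  assumes "f differentiable (at x)" "g differentiable (at x)"
  shows "pd i (\<lambda>y. f y * g y) x = pd i f x * g x + f x * pd i g x"
  using pd_scaleR[OF assms] by simp

lemma smooth_on_imp_differentiable:
  assumes "smooth_on S f" "x \<in> S" shows "f differentiable (at x)"
  using assms(1)[unfolded smooth_on_def, rule_format, of "Suc 0"] assms(2) by simp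

lemma smooth_on_imp_continuous_on: "smooth_on S f \<Longrightarrow> continuous_on S f"
  unfolding smooth_on_def using Ck_on.simps(1) by blast

lemma smooth_on_pd: "smooth_on S f \<Longrightarrow> smooth_on S (pd i f)"
  unfolding smooth_on_def using Ck_on.simps(2)[of _ S f] by (auto simp: pd_def[abs_def])

lemma smooth_on_pd_commute:
  fixes f :: "real^'n::finite \<Rightarrow> 'b::real_inner"
  assumes f: "smooth_on S f" and S: "open S" "x \<in> S"
  shows "pd i (pd j f) x = pd j (pd i f) x"
proof -
  have "pd i (pd j f) x \<bullet> c = pd j (pd i f) x \<bullet> c" for c
  proof -
    note d = smooth_on_imp_differentiable[unfolded frechet_derivative_works]
    let ?D = "\<lambda>l y. (\<lambda>v. frechet_derivative (pd l f) (at y) v \<bullet> c)"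
    have *: "((\<lambda>z. frechet_derivative f (at z) (axis l 1) \<bullet> c) has_derivative ?D l y) (at y)"
      if "y \<in> S" for l y
      using has_derivative_inner_left[OF d[OF smooth_on_pd[OF f, of l] that], of c]
      by (simp add: pd_def[abs_def])
    have cont: "continuous_on S (\<lambda>y. ?D l y (axis m 1))" for l m
      using smooth_on_imp_continuous_on[OF smooth_on_pd[OF smooth_on_pd[OF f]], of m l]
      by (intro continuous_on_inner continuous_on_const) (simp add: pd_def[abs_def])
    have "?D j x (axis i 1) = ?D i x (axis j 1)"
      by (rule mixed_derivatives_commute[OF S, of "\<lambda>y. f y \<bullet> c"
            "\<lambda>y v. frechet_derivative f (at y) v \<bullet> c" "axis j 1" "?D j" "axis i 1" "?D i",
            OF has_derivative_inner_left[OF d[OF f]] * * cont cont])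
    then show ?thesis by (simp add: pd_def)
  qed
  then show ?thesis using vector_eq_rdot by blast
qed

section \<open>The space form in the conformal ball model\<close>

lemma matrix_inv_eqI:
  fixes A B :: "real^'n::finite^'n"
  assumes "A ** B = mat 1" shows "matrix_inv A = B"
proof -
  have "B ** A = mat 1" using assms matrix_left_right_inverse by blast
  moreover have "invertible A" unfolding invertible_def using assms calculation by blast
  then have "matrix_inv A ** A = mat 1"
    unfolding invertible_def matrix_inv_def by (rule someI_ex[THEN conjunct2])
  ultimately show ?thesis
    by (metis assms matrix_mul_assoc matrix_mul_lid matrix_mul_rid)
qed

definition conf_factor :: "real \<Rightarrow> real^'k::finite \<Rightarrow> real" where
  "conf_factor \<kappa> y = 1 / (1 - \<kappa>\<^sup>2 * (norm y)\<^sup>2 / 4)"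

text \<open>
  The Euclidean gradient of \<open>ln (conf_factor \<kappa>)\<close>, see \<open>has_derivative_conf_factor\<close>.
\<close>

definition log_grad :: "real \<Rightarrow> real^'k::finite \<Rightarrow> real^'k" where
  "log_grad \<kappa> y = (\<kappa>\<^sup>2 / 2 * conf_factor \<kappa> y) *\<^sub>R y"

lemma conf_factor_pos: "y \<in> sf_domain \<kappa> \<Longrightarrow> conf_factor \<kappa> y > 0"
  by (simp add: conf_factor_def sf_domain_def)

lemma has_derivative_conf_factor:
  assumes "y \<in> sf_domain \<kappa>"
  shows "(conf_factor \<kappa> has_derivative (\<lambda>v. conf_factor \<kappa> y * (log_grad \<kappa> y \<bullet> v))) (at y)"
proof -
  have "1 - \<kappa>\<^sup>2 * (y \<bullet> y) / 4 \<noteq> 0"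
    using assms by (simp add: sf_domain_def power2_norm_eq_inner)
  then have "((\<lambda>y. 1 / (1 - \<kappa>\<^sup>2 * (y \<bullet> y) / 4)) has_derivative
      (\<lambda>v. conf_factor \<kappa> y * (log_grad \<kappa> y \<bullet> v))) (at y)"
    by (auto intro!: derivative_eq_intros
        simp: conf_factor_def log_grad_def power2_norm_eq_inner inner_commute divide_simps)
  then show ?thesis
    by (simp add: conf_factor_def[abs_def] power2_norm_eq_inner)
qed

lemma sf_metric_nth: "sf_metric \<kappa> y $ i $ j = (if i = j then (conf_factor \<kappa> y)\<^sup>2 else 0)"
  by (simp add: sf_metric_def conf_factor_def mat_def power_divide)

lemma metric_ip_sf: "metric_ip (sf_metric \<kappa>) y u v = (conf_factor \<kappa> y)\<^sup>2 * (u \<bullet> v)"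
  by (simp add: metric_ip_def sf_metric_nth inner_vec_def sum_distrib_left mult.assoc
      if_distrib[of "\<lambda>t. t * _"] sum.delta cong: if_cong)

lemma pd_sf_metric:
  assumes "y \<in> sf_domain \<kappa>"
  shows "pd i (\<lambda>z. sf_metric \<kappa> z $ j $ l) y
    = (if j = l then 2 * (conf_factor \<kappa> y)\<^sup>2 * log_grad \<kappa> y $ i else 0)"
proof -
  have "((\<lambda>z. (conf_factor \<kappa> z)\<^sup>2) has_derivative
      (\<lambda>v. 2 * (conf_factor \<kappa> y)\<^sup>2 * (log_grad \<kappa> y \<bullet> v))) (at y)"
    using has_derivative_conf_factor[OF assms]
    by (auto intro!: derivative_eq_intros simp: power2_eq_square algebra_simps)
  from pd_eqI[OF this, of i] have "pd i (\<lambda>z. (conf_factor \<kappa> z)\<^sup>2) y = 2 * (conf_factor \<kappa> y)\<^sup>2 * log_grad \<kappa> y $ i"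
    by (simp add: inner_axis)
  moreover have "pd i (\<lambda>z::real^'a. 0::real) y = 0"
    by (simp add: pd_def)
  ultimately show ?thesis by (simp add: sf_metric_nth)
qed

lemma matrix_inv_sf_metric:
  assumes "y \<in> sf_domain \<kappa>"
  shows "matrix_inv (sf_metric \<kappa> y) = (1 / (conf_factor \<kappa> y)\<^sup>2) *\<^sub>R mat 1"
proof (rule matrix_inv_eqI)
  show "sf_metric \<kappa> y ** (1 / (conf_factor \<kappa> y)\<^sup>2) *\<^sub>R mat 1 = mat 1"
    using conf_factor_pos[OF assms]
    by (simp add: vec_eq_iff matrix_matrix_mult_def sf_metric_nth mat_def
        if_distrib[of "\<lambda>t. t * _"] if_distrib[of "\<lambda>t. t / _"] sum.delta cong: if_cong)
qed

text \<open>
  The usual formula for a conformally flat metric \<open>\<phi>\<^sup>2 \<bar>dy\<bar>\<^sup>2\<close>, whose connection depends on the metric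
  through \<open>d (ln \<phi>)\<close> only.
\<close>

lemma christoffel_sf:
  assumes "y \<in> sf_domain \<kappa>"
  shows "christoffel (sf_metric \<kappa>) y i j k =
    (if j = k then log_grad \<kappa> y $ i else 0) + (if i = k then log_grad \<kappa> y $ j else 0)
    - (if i = j then log_grad \<kappa> y $ k else 0)"
  using conf_factor_pos[OF assms]
  by (simp add: christoffel_def matrix_inv_sf_metric[OF assms] pd_sf_metric[OF assms] mat_def
      if_distrib[of "\<lambda>t. t * _"] if_distrib[of "\<lambda>t. t / _"] sum.delta cong: if_cong)

lemma cov_along_sf:
  assumes "F x \<in> sf_domain \<kappa>"
  shows "cov_along (sf_metric \<kappa>) F V i x = pd i V x
    + (log_grad \<kappa> (F x) \<bullet> pd i F x) *\<^sub>R V x + (log_grad \<kappa> (F x) \<bullet> V x) *\<^sub>R pd i F x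
    - (pd i F x \<bullet> V x) *\<^sub>R log_grad \<kappa> (F x)"
  by (simp add: cov_along_def christoffel_sf[OF assms] vec_eq_iff inner_vec_def algebra_simps
      sum.distrib sum_subtractf sum_distrib_left sum_distrib_right
      if_distrib[of "\<lambda>t. t * _"] if_distrib[of "\<lambda>t. _ * t"] sum.delta cong: if_cong)
    (subst sum.swap, simp)

lemma differentiable_compose_pd:
  fixes F :: "real^'n::finite \<Rightarrow> real^'k::finite"
  assumes "(f has_derivative f') (at (F x))" "F differentiable (at x)"
  shows "(\<lambda>z. f (F z)) differentiable (at x)" "pd i (\<lambda>z. f (F z)) x = f' (pd i F x)"
proof -
  have "(F has_derivative frechet_derivative F (at x)) (at x)"
    using assms(2) by (simp add: frechet_derivative_works)
  then have *: "((\<lambda>z. f (F z)) has_derivative (\<lambda>v. f' (frechet_derivative F (at x) v))) (at x)"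
    by (rule has_derivative_compose) (rule assms)
  show "(\<lambda>z. f (F z)) differentiable (at x)" using * by (rule differentiableI)
  show "pd i (\<lambda>z. f (F z)) x = f' (pd i F x)" using pd_eqI[OF *] by (simp add: pd_def)
qed

text \<open>
  The derivative of \<open>log_grad\<close> is a multiple of the identity plus the square of \<open>log_grad\<close>. This shape
  of the Hessian of the logarithmic conformal factor expresses that the ambient curvature is
  constant, and it is what makes the Codazzi equation hold without a curvature term.
\<close>

lemma has_derivative_log_grad:
  assumes "y \<in> sf_domain \<kappa>"
  shows "(log_grad \<kappa> has_derivative
    (\<lambda>v. (\<kappa>\<^sup>2 / 2 * conf_factor \<kappa> y) *\<^sub>R v + (log_grad \<kappa> y \<bullet> v) *\<^sub>R log_grad \<kappa> y)) (at y)"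
  unfolding log_grad_def[abs_def]
  by (auto intro!: derivative_eq_intros has_derivative_conf_factor[OF assms]
      simp: log_grad_def algebra_simps)

text \<open>
  The ambient connection along \<open>F\<close> is metric: the derivative of the factor \<open>(conf_factor \<kappa>)\<^sup>2\<close> is split evenly
  between the two arguments, and the two remaining correction terms cancel.
\<close>

lemma metric_compatible:
  fixes F V W :: "real^'n::finite \<Rightarrow> real^'k::finite"
  assumes F: "F x \<in> sf_domain \<kappa>" "F differentiable (at x)"
    and VW: "V differentiable (at x)" "W differentiable (at x)"
  shows "pd i (\<lambda>z. metric_ip (sf_metric \<kappa>) (F z) (V z) (W z)) x =
    metric_ip (sf_metric \<kappa>) (F x) (cov_along (sf_metric \<kappa>) F V i x) (W x) +
    metric_ip (sf_metric \<kappa>) (F x) (V x) (cov_along (sf_metric \<kappa>) F W i x)"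
proof -
  have c: "((\<lambda>y. (conf_factor \<kappa> y)\<^sup>2) has_derivative
      (\<lambda>v. 2 * (conf_factor \<kappa> (F x))\<^sup>2 * (log_grad \<kappa> (F x) \<bullet> v))) (at (F x))"
    using has_derivative_conf_factor[OF F(1)]
    by (auto intro!: derivative_eq_intros simp: power2_eq_square algebra_simps)
  note d = differentiable_compose_pd[OF c F(2)]
  show ?thesis
    unfolding metric_ip_sf cov_along_sf[of F, OF F(1)]
    by (subst pd_mult[OF d(1)])
      (use VW in \<open>auto intro!: differentiable_inner
        simp: pd_inner d(2) inner_add_left inner_add_right inner_diff_left inner_diff_right
          algebra_simps inner_commute\<close>)
qed

lemma metric_ip_sf_commute: "metric_ip (sf_metric \<kappa>) y u v = metric_ip (sf_metric \<kappa>) y v u"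
  by (simp add: metric_ip_sf inner_commute)

section \<open>Parametrised hypersurfaces and the Codazzi equation\<close>

text \<open>
  What a chart sees of a two-sided immersion into the space form. The Codazzi equation is local, so
  it can be proved for such a parametrised patch.
\<close>

locale sf_patch =
  fixes \<kappa> :: real and S :: "(real^'n::finite) set" and F N :: "real^'n \<Rightarrow> real^'k::finite"
  assumes codim: "CARD('k) = CARD('n) + 1"
    and open_S: "open S"
    and in_domain: "x \<in> S \<Longrightarrow> F x \<in> sf_domain \<kappa>"
    and smooth_F: "smooth_on S F" and smooth_N: "smooth_on S N"
    and immersion: "x \<in> S \<Longrightarrow> inj (frechet_derivative F (at x))"
    and unit: "x \<in> S \<Longrightarrow> metric_ip (sf_metric \<kappa>) (F x) (N x) (N x) = 1"
    and normal: "x \<in> S \<Longrightarrow> metric_ip (sf_metric \<kappa>) (F x) (N x) (pd i F x) = 0"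
begin

abbreviation "ip x \<equiv> metric_ip (sf_metric \<kappa>) (F x)"
abbreviation "D \<equiv> \<lambda>i V x. cov_along (sf_metric \<kappa>) F V i x"
abbreviation "g \<equiv> induced_metric (sf_metric \<kappa>) F"
abbreviation "h \<equiv> second_ff (sf_metric \<kappa>) F N"
abbreviation "ginv x \<equiv> matrix_inv (g x)"

lemmas diff_F = smooth_on_imp_differentiable[OF smooth_F]
lemmas diff_N = smooth_on_imp_differentiable[OF smooth_N]
lemmas diff_pd_F = smooth_on_imp_differentiable[OF smooth_on_pd[OF smooth_F]]
lemmas diff_pd_N = smooth_on_imp_differentiable[OF smooth_on_pd[OF smooth_N]]
lemmas D_eq = cov_along_sf[of F, OF in_domain]
lemmas pd_ip = metric_compatible[of F, OF in_domain diff_F]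

text \<open>
  The only second derivatives of \<open>F\<close> here are \<open>\<partial>\<^sub>i\<partial>\<^sub>lF\<close>, which commute; the Christoffel part is
  visibly symmetric.
\<close>

lemma torsion_free: "x \<in> S \<Longrightarrow> D i (pd l F) x = D l (pd i F) x"
  by (simp add: D_eq smooth_on_pd_commute[OF smooth_F open_S, of x i l] inner_commute)

text \<open>
  The Koszul argument: the induced connection is the tangential part of the ambient one.
\<close>

lemma christoffel_induced:
  assumes x: "x \<in> S"
  shows "christoffel g x i l m = (\<Sum>p\<in>UNIV. ginv x $ m $ p * ip x (D i (pd l F) x) (pd p F x))"
proof -
  have "pd i (\<lambda>y. g y $ l $ p) x + pd l (\<lambda>y. g y $ i $ p) x - pd p (\<lambda>y. g y $ i $ l) x
      = 2 * ip x (D i (pd l F) x) (pd p F x)" for p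
    using torsion_free[OF x, of i p] torsion_free[OF x, of l p] torsion_free[OF x, of i l]
    by (simp add: induced_metric_def pd_ip[OF x x diff_pd_F diff_pd_F, OF x x]
        metric_ip_sf_commute[of _ _ "pd _ F x"])
  then show ?thesis
    by (simp add: christoffel_def sum_distrib_left algebra_simps)
qed

text \<open>
  Differentiating \<open>\<langle>N, \<partial>\<^sub>jF\<rangle> = 0\<close>, and below \<open>\<langle>N, N\<rangle> = 1\<close>, gives the tangential and the normal
  part of the derivative of the normal field.
\<close>

lemma D_normal_tangent:
  assumes x: "x \<in> S" shows "ip x (D i N x) (pd j F x) = - ip x (N x) (D i (pd j F) x)"
proof -
  have "pd i (\<lambda>y. ip y (N y) (pd j F y)) x = 0"
    using pd_cong_open[OF open_S x normal] by (simp add: pd_const)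
  then show ?thesis
    by (simp add: pd_ip[OF x x diff_N diff_pd_F, OF x x])
qed

lemma D_normal_normal:
  assumes x: "x \<in> S" shows "ip x (D i N x) (N x) = 0"
proof -
  have "pd i (\<lambda>y. ip y (N y) (N y)) x = 0"
    using pd_cong_open[OF open_S x unit] by (simp add: pd_const)
  then show ?thesis
    by (simp add: pd_ip[OF x x diff_N diff_N, OF x x] metric_ip_sf_commute[of _ _ "N x"])
qed

lemma second_ff_symmetric: "x \<in> S \<Longrightarrow> h x $ i $ j = h x $ j $ i"
  by (simp add: second_ff_def D_normal_tangent torsion_free[of x i j])

lemma derivative_expand:
  assumes x: "x \<in> S"
  shows "frechet_derivative F (at x) v = (\<Sum>i\<in>UNIV. v $ i *\<^sub>R pd i F x)"
proof -
  have lin: "linear (frechet_derivative F (at x))"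
    by (rule linear_frechet_derivative[OF diff_F[OF x]])
  have "v = (\<Sum>i\<in>UNIV. v $ i *\<^sub>R axis i 1)"
    using basis_expansion[of v] by (simp add: scalar_mult_eq_scaleR)
  then have "frechet_derivative F (at x) v
      = frechet_derivative F (at x) (\<Sum>i\<in>UNIV. v $ i *\<^sub>R axis i 1)" by simp
  also have "\<dots> = (\<Sum>i\<in>UNIV. v $ i *\<^sub>R pd i F x)"
    by (simp add: linear_sum[OF lin] linear_cmul[OF lin] pd_def)
  finally show ?thesis .
qed

lemma induced_metric_inner:
  assumes x: "x \<in> S"
  shows "v \<bullet> (g x *v w)
    = (conf_factor \<kappa> (F x))\<^sup>2 * (frechet_derivative F (at x) v \<bullet> frechet_derivative F (at x) w)"
  by (simp add: derivative_expand[OF x] inner_sum_left inner_sum_right inner_vec_def[of v]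
      matrix_vector_mult_def induced_metric_def metric_ip_sf sum_distrib_left ac_simps)
    (rule sum.swap)

lemma induced_metric_pos:
  assumes x: "x \<in> S" and v: "v \<noteq> 0"
  shows "v \<bullet> (g x *v v) > 0"
proof -
  have "frechet_derivative F (at x) v \<noteq> frechet_derivative F (at x) 0"
    using immersion[OF x] v by (auto dest: injD)
  then have "frechet_derivative F (at x) v \<noteq> 0"
    by (simp add: derivative_expand[OF x, of 0])
  then show ?thesis
    using conf_factor_pos[OF in_domain[OF x]] by (simp add: induced_metric_inner[OF x])
qed

lemma induced_metric_symmetric: "g x $ i $ j = g x $ j $ i"
  by (simp add: induced_metric_def metric_ip_sf_commute[of _ _ "pd i F x"])

lemma induced_metric_inverse:
  assumes x: "x \<in> S" shows "g x ** ginv x = mat 1" "ginv x ** g x = mat 1"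
proof -
  have "v = 0" if "g x *v v = 0" for v
    using induced_metric_pos[OF x, of v] that by force
  then obtain B where "B ** g x = mat 1"
    using matrix_left_invertible_ker[of "g x"] by blast
  then have "g x ** B = mat 1" using matrix_left_right_inverse by blast
  then show "g x ** ginv x = mat 1" by (simp add: matrix_inv_eqI)
  then show "ginv x ** g x = mat 1" using matrix_left_right_inverse by blast
qed

text \<open>
  This is where codimension one enters: \<open>(v, t) \<mapsto> dF v + t N\<close> is injective between spaces of equal
  dimension, hence onto, so that \<open>Z\<close> is orthogonal to itself.
\<close>

lemma frame_spans:
  assumes x: "x \<in> S" and n: "Z \<bullet> N x = 0" and t: "\<And>p. Z \<bullet> pd p F x = 0"
  shows "Z = 0"
proof -
  let ?L = "\<lambda>(v, t::real). frechet_derivative F (at x) v + t *\<^sub>R N x"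
  have lin: "linear (frechet_derivative F (at x))"
    by (rule linear_frechet_derivative[OF diff_F[OF x]])
  have L: "linear ?L"
    by (rule linearI) (auto simp: linear_add[OF lin] linear_cmul[OF lin] algebra_simps)
  have NN: "N x \<bullet> N x \<noteq> 0"
    using unit[OF x] by (auto simp: metric_ip_sf)
  have Nt: "N x \<bullet> frechet_derivative F (at x) v = 0" for v
    using normal[OF x] conf_factor_pos[OF in_domain[OF x]]
    by (simp add: derivative_expand[OF x] inner_sum_right metric_ip_sf)
  have "inj ?L"
  proof (subst linear_injective_0[OF L], clarify)
    fix v t assume 0: "frechet_derivative F (at x) v + t *\<^sub>R N x = 0"
    have "t * (N x \<bullet> N x) = N x \<bullet> (frechet_derivative F (at x) v + t *\<^sub>R N x)"
      by (simp add: inner_add_right Nt)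
    then have t: "t = 0" using 0 NN by simp
    then have "frechet_derivative F (at x) v = frechet_derivative F (at x) 0"
      using 0 by (simp add: linear_0[OF lin])
    then have "v = 0" using immersion[OF x] by (auto dest: injD)
    with t show "(v, t) = 0" by (simp add: zero_prod_def)
  qed
  then have "surj ?L"
    by (rule linear_injective_imp_surjective[OF L]) (simp add: codim)
  then obtain v t where Z: "Z = frechet_derivative F (at x) v + t *\<^sub>R N x"
    by (metis (mono_tags, lifting) case_prod_conv surjD surj_pair)
  have "Z \<bullet> Z = Z \<bullet> (frechet_derivative F (at x) v + t *\<^sub>R N x)" using Z by simp
  also have "\<dots> = 0"
    using n t by (simp add: derivative_expand[OF x] inner_add_right inner_sum_right)
  finally show ?thesis by simp
qed

text \<open>
  Both sides have no normal part and the same inner products with the coordinate frame, so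
  \<open>frame_spans\<close> applies to their difference.
\<close>

lemma weingarten_equation:
  assumes x: "x \<in> S"
  shows "D k N x = (\<Sum>p\<in>UNIV. (\<Sum>m\<in>UNIV. h x $ k $ m * ginv x $ m $ p) *\<^sub>R pd p F x)"
    (is "_ = ?W")
proof -
  have pos: "conf_factor \<kappa> (F x) > 0" by (rule conf_factor_pos[OF in_domain[OF x]])
  have "D k N x - ?W = 0"
  proof (rule frame_spans[OF x])
    have "D k N x \<bullet> N x = 0"
      using D_normal_normal[OF x, of k] pos by (simp add: metric_ip_sf)
    moreover have "pd p F x \<bullet> N x = 0" for p
      using normal[OF x, of p] pos by (simp add: metric_ip_sf inner_commute)
    ultimately show "(D k N x - ?W) \<bullet> N x = 0"
      by (simp add: inner_diff_left inner_sum_left)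
  next
    fix q
    have "ip x ?W (pd q F x) = (\<Sum>p\<in>UNIV. (h x ** ginv x) $ k $ p * g x $ p $ q)"
      by (simp add: metric_ip_sf inner_sum_left sum_distrib_left induced_metric_def
          matrix_matrix_mult_def ac_simps)
    also have "\<dots> = ((h x ** ginv x) ** g x) $ k $ q"
      by (simp add: matrix_matrix_mult_def[of "h x ** ginv x"])
    also have "\<dots> = h x $ k $ q"
      by (simp add: matrix_mul_assoc[symmetric] induced_metric_inverse[OF x])
    finally show "(D k N x - ?W) \<bullet> pd q F x = 0"
      using pos by (simp add: second_ff_def metric_ip_sf inner_diff_left)
  qed
  then show ?thesis by simp
qed

text \<open>
  By the Weingarten equation, the Christoffel correction in \<open>\<nabla>\<^sub>ih\<^sub>k\<^sub>l\<close> belonging to the index \<open>l\<close> is an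
  ambient inner product. It is the second half of the product rule for \<open>h\<^sub>k\<^sub>l = \<langle>D\<^sub>kN, \<partial>\<^sub>lF\<rangle>\<close>, so
  subtracting it from \<open>\<partial>\<^sub>ih\<^sub>k\<^sub>l\<close> leaves \<open>\<langle>D\<^sub>iD\<^sub>kN, \<partial>\<^sub>lF\<rangle>\<close>.
\<close>

lemma nabla_h_term:
  assumes x: "x \<in> S"
  shows "(\<Sum>m\<in>UNIV. christoffel g x i l m * h x $ k $ m) = ip x (D k N x) (D i (pd l F) x)"
proof -
  let ?Y = "D i (pd l F) x"
  have "ip x (D k N x) ?Y =
      (\<Sum>p\<in>UNIV. \<Sum>m\<in>UNIV. h x $ k $ m * ginv x $ m $ p * ip x (pd p F x) ?Y)"
    unfolding weingarten_equation[OF x, of k]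
    by (simp add: metric_ip_sf inner_sum_left sum_distrib_left sum_distrib_right ac_simps)
  also have "\<dots> = (\<Sum>m\<in>UNIV. \<Sum>p\<in>UNIV. h x $ k $ m * ginv x $ m $ p * ip x (pd p F x) ?Y)"
    by (rule sum.swap)
  also have "\<dots> = (\<Sum>m\<in>UNIV. christoffel g x i l m * h x $ k $ m)"
    by (simp add: christoffel_induced[OF x] sum_distrib_left sum_distrib_right
        metric_ip_sf_commute[of _ _ ?Y] ac_simps)
  finally show ?thesis by simp
qed

text \<open>
  The last term of \<open>cov_along_sf\<close> vanishes on the whole patch, so it may be dropped before
  differentiating a second time.
\<close>

lemma D_normal_eq:
  assumes x: "x \<in> S"
  shows "D k N x = pd k N x + (log_grad \<kappa> (F x) \<bullet> pd k F x) *\<^sub>R N x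
    + (log_grad \<kappa> (F x) \<bullet> N x) *\<^sub>R pd k F x"
  using normal[OF x, of k] conf_factor_pos[OF in_domain[OF x]]
  by (simp add: D_eq[OF x] metric_ip_sf inner_commute)

lemma log_grad_F:
  assumes x: "x \<in> S"
  shows "(\<lambda>y. log_grad \<kappa> (F y)) differentiable (at x)"
    and "pd i (\<lambda>y. log_grad \<kappa> (F y)) x = (\<kappa>\<^sup>2 / 2 * conf_factor \<kappa> (F x)) *\<^sub>R pd i F x
      + (log_grad \<kappa> (F x) \<bullet> pd i F x) *\<^sub>R log_grad \<kappa> (F x)"
  using differentiable_compose_pd[OF has_derivative_log_grad[OF in_domain[OF x]] diff_F[OF x]]
  by auto

lemma D_normal_differentiable:
  assumes x: "x \<in> S"
  shows "(\<lambda>y. D k N y) differentiable (at x)"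
    and "pd i (\<lambda>y. D k N y) x = pd i (pd k N) x
      + ((pd i (\<lambda>y. log_grad \<kappa> (F y)) x \<bullet> pd k F x) + (log_grad \<kappa> (F x) \<bullet> pd i (pd k F) x)) *\<^sub>R N x
      + (log_grad \<kappa> (F x) \<bullet> pd k F x) *\<^sub>R pd i N x
      + ((pd i (\<lambda>y. log_grad \<kappa> (F y)) x \<bullet> N x) + (log_grad \<kappa> (F x) \<bullet> pd i N x)) *\<^sub>R pd k F x
      + (log_grad \<kappa> (F x) \<bullet> N x) *\<^sub>R pd i (pd k F) x"
proof -
  let ?w = "\<lambda>y. log_grad \<kappa> (F y)"
  let ?V = "\<lambda>y. pd k N y + (?w y \<bullet> pd k F y) *\<^sub>R N y + (?w y \<bullet> N y) *\<^sub>R pd k F y"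
  note d = diff_F[OF x] diff_N[OF x] diff_pd_F[OF x] diff_pd_N[OF x] log_grad_F(1)[OF x]
  have V: "?V differentiable (at x)"
    by (intro d differentiable_add differentiable_scaleR differentiable_inner)
  then show "(\<lambda>y. D k N y) differentiable (at x)"
  proof -
    obtain V' where "(?V has_derivative V') (at x)"
      using V unfolding differentiable_def by blast
    then have "(D k N has_derivative V') (at x)"
      by (rule has_derivative_transform_within_open[OF _ open_S x]) (rule D_normal_eq[symmetric])
    then show ?thesis by (rule differentiableI)
  qed
  have "pd i (\<lambda>y. D k N y) x = pd i ?V x"
    by (rule pd_cong_open[OF open_S x D_normal_eq])
  also have "\<dots> = pd i (pd k N) x
      + ((pd i ?w x \<bullet> pd k F x) + (?w x \<bullet> pd i (pd k F) x)) *\<^sub>R N x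
      + (?w x \<bullet> pd k F x) *\<^sub>R pd i N x
      + ((pd i ?w x \<bullet> N x) + (?w x \<bullet> pd i N x)) *\<^sub>R pd k F x
      + (?w x \<bullet> N x) *\<^sub>R pd i (pd k F) x"
    by (simp add: d pd_add pd_scaleR pd_inner differentiable_inner differentiable_scaleR
        differentiable_add add.assoc)
  finally show "pd i (\<lambda>y. D k N y) x = \<dots>" .
qed

text \<open>
  The difference of the two sides is the ambient curvature \<open>R(\<partial>\<^sub>iF, \<partial>\<^sub>kF)N\<close>. It vanishes because the
  curvature is constant and \<open>N\<close> is orthogonal to both \<open>\<partial>\<^sub>iF\<close> and \<open>\<partial>\<^sub>kF\<close>. In coordinates all terms
  cancel once second partial derivatives commute and \<open>\<langle>\<partial>\<^sub>iF, \<partial>\<^sub>kN\<rangle>\<close> is known to be symmetric.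
\<close>

lemma D_D_normal_commute:
  assumes x: "x \<in> S"
  shows "D i (\<lambda>y. D k N y) x = D k (\<lambda>y. D i N y) x"
proof -
  have c: "conf_factor \<kappa> (F x) > 0" by (rule conf_factor_pos[OF in_domain[OF x]])
  have t: "pd p F x \<bullet> N x = 0" for p
    using normal[OF x, of p] c by (simp add: metric_ip_sf inner_commute)
  \<comment> \<open>the symmetry of \<open>h\<close>, with the symmetric lower order terms removed\<close>
  have e: "pd i F x \<bullet> pd k N x = pd k F x \<bullet> pd i N x"
    using second_ff_symmetric[OF x, of i k] c t
    by (simp add: second_ff_def metric_ip_sf D_normal_eq[OF x] inner_add_left inner_add_right inner_commute)
  show ?thesis
    unfolding D_eq[OF x, where V="D k N"] D_eq[OF x, where V="D i N"] D_normal_differentiable(2)[OF x] log_grad_F(2)[OF x]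
      smooth_on_pd_commute[OF smooth_F open_S x, of i k]
      smooth_on_pd_commute[OF smooth_N open_S x, of i k] D_normal_eq[OF x]
    by (simp add: inner_add_left inner_add_right t e algebra_simps inner_commute[of "pd k F x" "pd i F x"])
      (simp add: vec_eq_iff algebra_simps)
qed

text \<open>
  After \<open>nabla_h_term\<close>, both sides are \<open>\<langle>D\<^sub>iD\<^sub>kN, \<partial>\<^sub>lF\<rangle>\<close> up to the term containing the Christoffel
  symbols with lower indices \<open>i\<close> and \<open>k\<close>, which are symmetric.
\<close>

lemma codazzi:
  assumes x: "x \<in> S"
  shows "nabla_h (sf_metric \<kappa>) F N x i k l = nabla_h (sf_metric \<kappa>) F N x k i l"
proof -
  have 1: "pd i (\<lambda>y. h y $ k $ l) x - (\<Sum>m\<in>UNIV. christoffel g x i l m * h x $ k $ m)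
      = ip x (D i (\<lambda>y. D k N y) x) (pd l F x)" for i k
    unfolding nabla_h_term[OF x]
    by (simp add: second_ff_def pd_ip[OF x x D_normal_differentiable(1) diff_pd_F, OF x x])
  have 2: "christoffel g x i k m = christoffel g x k i m" for m
    using torsion_free[OF x, of i k] by (simp add: christoffel_induced[OF x])
  show ?thesis
    unfolding nabla_h_def
    using 1[of i k] 1[of k i] by (simp add: 2 D_D_normal_commute[OF x, of i k])
qed

end

section \<open>Simultaneous diagonalisation of two quadratic forms\<close>

text \<open>
  The first order condition at a minimum of a quadratic polynomial. Evaluating at \<open>- P / (Q + 1)\<close>
  instead of \<open>- P / Q\<close> covers the case \<open>Q = 0\<close> as well.
\<close>

lemma nonneg_quadratic_linear_coeff:
  fixes P Q :: real
  assumes nonneg: "\<And>t. 0 \<le> t * (2 * P) + t\<^sup>2 * Q" and Q: "0 \<le> Q"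
  shows "P = 0"
proof (rule ccontr)
  assume P: "P \<noteq> 0"
  define t where "t = - P / (Q + 1)"
  have tP: "t * (Q + 1) = - P" using Q by (simp add: t_def)
  have "t * (2 * P) + t\<^sup>2 * Q = t * (2 * P) + t * (t * (Q + 1)) - t\<^sup>2"
    by (simp add: algebra_simps power2_eq_square)
  also have "\<dots> = - P\<^sup>2 / (Q + 1) - t\<^sup>2"
    unfolding tP by (simp add: t_def power2_eq_square field_simps)
  also have "\<dots> < 0"
  proof -
    have "P\<^sup>2 / (Q + 1) > 0" using P Q by simp
    then show ?thesis by (smt (verit) minus_divide_left zero_le_power2)
  qed
  finally show False using nonneg[of t] by simp
qed

text \<open>
  Induction on the dimension. A maximiser \<open>w\<close> of the Rayleigh quotient \<open>q v v / b v v\<close> on \<open>V\<close>, with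
  maximum \<open>\<mu>\<close>, is a zero of the nonnegative form \<open>\<mu> b - q\<close>, hence \<open>q w y = \<mu> b w y\<close> for all \<open>y \<in> V\<close>.
  So the \<open>b\<close>-orthogonal complement of \<open>w\<close> in \<open>V\<close> is also \<open>q\<close>-orthogonal to \<open>w\<close>, and the
  induction hypothesis applies to it.
\<close>

lemma simultaneous_diagonalization:
  fixes b q :: "'a::euclidean_space \<Rightarrow> 'a \<Rightarrow> real"
  assumes b: "bilinear b" "\<And>u v. b u v = b v u" "\<And>v. v \<noteq> 0 \<Longrightarrow> b v v > 0"
    and q: "bilinear q" "\<And>u v. q u v = q v u"
    and V: "subspace V"
  shows "\<exists>B\<subseteq>V. finite B \<and> card B = dim V \<and> (\<forall>v\<in>B. b v v = 1) \<and>
    (\<forall>u\<in>B. \<forall>v\<in>B. u \<noteq> v \<longrightarrow> b u v = 0 \<and> q u v = 0)"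
  using V
proof (induction "dim V" arbitrary: V)
  case 0
  then show ?case by (intro exI[of _ "{}"]) auto
next
  case (Suc m)
  note bl = bilinear_ladd[OF b(1)] bilinear_radd[OF b(1)] bilinear_lmul[OF b(1)] bilinear_rmul[OF b(1)]
    bilinear_rsub[OF b(1)]
  note ql = bilinear_ladd[OF q(1)] bilinear_radd[OF q(1)] bilinear_lmul[OF q(1)] bilinear_rmul[OF q(1)]
  have cont: "continuous_on S (\<lambda>v. f v v)" if "bilinear f" for S and f :: "'a \<Rightarrow> 'a \<Rightarrow> real"
    using bounded_bilinear.continuous_on[of f S "\<lambda>v. v" "\<lambda>v. v"] that
    by (simp add: bilinear_conv_bounded_bilinear)
  let ?K = "V \<inter> sphere 0 1" and ?r = "\<lambda>v. q v v / b v v"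
  have K0: "v \<noteq> 0" if "v \<in> ?K" for v using that by auto
  have "compact ?K"
    using closed_subspace[OF Suc.prems] by (simp add: closed_Int_compact)
  moreover have "?K \<noteq> {}"
  proof -
    have "\<not> V \<subseteq> {0}" using Suc.hyps(2) dim_eq_0[of V] by linarith
    then obtain v where v: "v \<in> V" "v \<noteq> 0" by blast
    then have "v /\<^sub>R norm v \<in> ?K" using Suc.prems by (simp add: subspace_scale)
    then show ?thesis by blast
  qed
  moreover have "continuous_on ?K ?r"
    using b(3)[OF K0] by (intro continuous_on_divide cont b(1) q(1)) force
  ultimately have "\<exists>w\<in>?K. \<forall>v\<in>?K. ?r v \<le> ?r w"
    by (rule continuous_attains_sup)
  then obtain w where w: "w \<in> ?K" "\<And>v. v \<in> ?K \<Longrightarrow> ?r v \<le> ?r w"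
    by blast
  define \<mu> where "\<mu> = ?r w"
  have w0: "b w w > 0" using b(3) K0[OF w(1)] by blast
  have le: "q v v \<le> \<mu> * b v v" if "v \<in> V" for v
  proof (cases "v = 0")
    case True
    then show ?thesis using bilinear_lzero[OF q(1)] bilinear_lzero[OF b(1)] by simp
  next
    case False
    let ?u = "v /\<^sub>R norm v"
    have "?u \<in> ?K" using that False Suc.prems by (simp add: subspace_scale)
    from w(2)[OF this] have "?r ?u \<le> \<mu>" by (simp add: \<mu>_def)
    moreover have "?r ?u = ?r v" using False by (simp add: bl ql)
    ultimately show ?thesis using b(3)[OF False] by (simp add: divide_le_eq)
  qed
  have quad: "f (w + t *\<^sub>R y) (w + t *\<^sub>R y) = f w w + t * (2 * f w y) + t\<^sup>2 * f y y"
    if "bilinear f" "\<And>u v. f u v = f v u" for f :: "'a \<Rightarrow> 'a \<Rightarrow> real" and t y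
    using that(2)[of y w]
    by (simp add: bilinear_ladd[OF that(1)] bilinear_radd[OF that(1)] bilinear_lmul[OF that(1)]
        bilinear_rmul[OF that(1)] power2_eq_square algebra_simps)
  have qw: "q w w = \<mu> * b w w" using w0 by (simp add: \<mu>_def)
  have crit: "q w y = \<mu> * b w y" if y: "y \<in> V" for y
  proof -
    have "0 \<le> t * (2 * (\<mu> * b w y - q w y)) + t\<^sup>2 * (\<mu> * b y y - q y y)" for t
    proof -
      have "w + t *\<^sub>R y \<in> V" using w(1) y Suc.prems by (simp add: subspace_add subspace_scale)
      from le[OF this] show ?thesis
        unfolding quad[OF q] quad[OF b(1,2)] qw by (simp add: algebra_simps)
    qed
    moreover have "0 \<le> \<mu> * b y y - q y y" using le[OF y] by simp
    ultimately have "\<mu> * b w y - q w y = 0" by (rule nonneg_quadratic_linear_coeff)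
    then show ?thesis by simp
  qed
  define e where "e = w /\<^sub>R sqrt (b w w)"
  have e: "e \<in> V" "b e e = 1" "\<And>y. y \<in> V \<Longrightarrow> q e y = \<mu> * b e y"
  proof -
    show "e \<in> V" using w(1) Suc.prems by (simp add: e_def subspace_scale)
    have "b e e = b w w / (sqrt (b w w))\<^sup>2"
      by (simp add: e_def bl power2_eq_square field_simps)
    then show "b e e = 1" using w0 by simp
    show "q e y = \<mu> * b e y" if "y \<in> V" for y
      using crit[OF that] by (simp add: e_def bl ql)
  qed
  define W where "W = {y \<in> V. b e y = 0}"
  have W: "subspace W"
    unfolding W_def using Suc.prems bilinear_rzero[OF b(1)] by (auto simp: subspace_def bl)
  have V: "V = span (insert e W)"
  proof
    show "V \<subseteq> span (insert e W)"
    proof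
      fix y assume y: "y \<in> V"
      have "y - b e y *\<^sub>R e \<in> W"
        using y e Suc.prems by (simp add: W_def bl subspace_diff subspace_scale)
      then have "(y - b e y *\<^sub>R e) + b e y *\<^sub>R e \<in> span (insert e W)"
        by (intro span_add span_scale span_base) auto
      then show "y \<in> span (insert e W)" by simp
    qed
    show "span (insert e W) \<subseteq> V"
      using e Suc.prems by (intro span_minimal) (auto simp: W_def)
  qed
  have "e \<notin> span W"
    unfolding span_eq_iff[THEN iffD2, OF W] using e by (simp add: W_def)
  then have "dim (span (insert e W)) = Suc (dim W)"
    by (simp add: dim_insert)
  then have dim: "Suc (dim W) = dim V" unfolding V[symmetric] by simp
  then have "m = dim W" using Suc.hyps(2) by simp
  from Suc.hyps(1)[OF this W] obtain B where B: "B \<subseteq> W" "finite B" "card B = dim W"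
    "\<forall>v\<in>B. b v v = 1" "\<forall>u\<in>B. \<forall>v\<in>B. u \<noteq> v \<longrightarrow> b u v = 0 \<and> q u v = 0" by blast
  have "e \<notin> B" using B(1) e by (auto simp: W_def)
  have ev: "b e v = 0 \<and> q e v = 0 \<and> b v e = 0 \<and> q v e = 0" if "v \<in> B" for v
    using that B(1) e(3)[of v] b(2)[of v e] q(2)[of v e] by (auto simp: W_def)
  show ?case
  proof (intro exI[of _ "insert e B"] conjI)
    show "card (insert e B) = dim V"
      using B \<open>e \<notin> B\<close> dim by simp
    show "\<forall>u\<in>insert e B. \<forall>v\<in>insert e B. u \<noteq> v \<longrightarrow> b u v = 0 \<and> q u v = 0"
      using ev B(5) by (metis insertE)
    show "insert e B \<subseteq> V" using B(1) e(1) by (auto simp: W_def)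
  qed (use B(2,4) e(2) in simp_all)
qed

section \<open>Eigenvalues and tensor norms in a diagonalising frame\<close>

text \<open>
  A basis \<open>e\<close> that is orthonormal for the inner product \<open>G\<close> and diagonalises the form \<open>A\<close>. For \<open>G\<close> the
  first and \<open>A\<close> the second fundamental form it consists of principal directions, with principal
  curvatures \<open>d\<close>.
\<close>

definition diagonalizing_frame ::
  "real^'n^'n \<Rightarrow> real^'n^'n \<Rightarrow> ('n::finite \<Rightarrow> real^'n) \<Rightarrow> ('n \<Rightarrow> real) \<Rightarrow> bool" where
  "diagonalizing_frame G A e d \<longleftrightarrow> (\<forall>a c.
     e a \<bullet> (G *v e c) = (if a = c then 1 else 0) \<and> e a \<bullet> (A *v e c) = (if a = c then d a else 0))"

lemma bilinear_matrix: "bilinear (\<lambda>u v. u \<bullet> ((A::real^'n::finite^'n) *v v))"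
  unfolding bilinear_def
  by (auto intro!: linearI simp: inner_add_left inner_add_right matrix_vector_right_distrib
      matrix_vector_mult_scaleR)

lemma symmetric_matrix_inner:
  fixes A :: "real^'n::finite^'n"
  assumes "\<And>i j. A $ i $ j = A $ j $ i"
  shows "u \<bullet> (A *v v) = v \<bullet> (A *v u)"
proof -
  have "transpose A = A" using assms by (simp add: transpose_def vec_eq_iff)
  then show ?thesis by (metis dot_lmul_matrix inner_commute transpose_matrix_vector)
qed

lemma diagonalizing_frame_exists:
  fixes G A :: "real^'n::finite^'n"
  assumes G: "\<And>i j. G $ i $ j = G $ j $ i" "\<And>v. v \<noteq> 0 \<Longrightarrow> v \<bullet> (G *v v) > 0"
    and A: "\<And>i j. A $ i $ j = A $ j $ i"
  obtains e d where "diagonalizing_frame G A e d"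
proof -
  have "\<exists>B\<subseteq>UNIV. finite B \<and> card B = dim (UNIV :: (real^'n) set) \<and> (\<forall>v\<in>B. v \<bullet> (G *v v) = 1) \<and>
      (\<forall>u\<in>B. \<forall>v\<in>B. u \<noteq> v \<longrightarrow> u \<bullet> (G *v v) = 0 \<and> u \<bullet> (A *v v) = 0)"
    by (rule simultaneous_diagonalization[OF bilinear_matrix symmetric_matrix_inner[OF G(1)] G(2)
        bilinear_matrix symmetric_matrix_inner[OF A] subspace_UNIV])
  then obtain B where B: "finite B" "card B = dim (UNIV :: (real^'n) set)"
    "\<forall>v\<in>B. v \<bullet> (G *v v) = 1"
    "\<forall>u\<in>B. \<forall>v\<in>B. u \<noteq> v \<longrightarrow> u \<bullet> (G *v v) = 0 \<and> u \<bullet> (A *v v) = 0"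
    by auto
  have "card (UNIV :: 'n set) = card B" using B(2) by simp
  then obtain e where e: "bij_betw e (UNIV :: 'n set) B"
    using finite_same_card_bij[OF finite_class.finite_UNIV B(1)] by blast
  then have eB: "e a \<in> B" and inj: "e a = e c \<longleftrightarrow> a = c" for a c
    by (auto simp: bij_betw_def inj_on_def)
  have "diagonalizing_frame G A e (\<lambda>a. e a \<bullet> (A *v e a))"
    unfolding diagonalizing_frame_def using B eB inj by auto
  then show ?thesis by (rule that)
qed

lemma constant_matrix_mult:
  "(\<chi> i j. [:(A ** B) $ i $ j:]) = (\<chi> i j. [:A $ i $ j:]) ** (\<chi> i j. [:(B::real^'n::finite^'n) $ i $ j:])"
proof -
  have "[:sum f K:] = (\<Sum>k\<in>K. [:f k:])" for f :: "'n \<Rightarrow> real" and K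
  proof (induction K rule: infinite_finite_induct)
    case (insert k K)
    have "[:f k + sum f K:] = [:f k:] + [:sum f K:]" by simp
    then show ?case using insert by simp
  qed auto
  then show ?thesis by (simp add: vec_eq_iff matrix_matrix_mult_def mult.commute)
qed

text \<open>
  The similarity is lifted to matrices over the polynomial ring; there \<open>mat [:0, 1:]\<close> is central, and
  \<open>det P\<close> can be cancelled as it is a unit.
\<close>

lemma charpoly_similar:
  fixes P W D :: "real^'n::finite^'n"
  assumes "P ** W = D ** P" and "Q ** P = mat 1"
  shows "charpoly W = charpoly D"
proof -
  let ?C = "\<lambda>A::real^'n^'n. (\<chi> i j. [:A $ i $ j:]) :: real poly^'n^'n"
  have "?C Q ** ?C P = mat 1"
    by (simp add: constant_matrix_mult[symmetric] assms) (simp add: vec_eq_iff mat_def)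
  then have "det (?C Q) * det (?C P) = 1" by (simp add: det_mul[symmetric])
  then have ne: "det (?C P) \<noteq> 0" by auto
  have X: "(mat [:0, 1:] :: real poly^'n^'n) ** ?C P = ?C P ** mat [:0, 1:]"
    by (simp add: vec_eq_iff matrix_matrix_mult_def mat_def if_distrib[of "\<lambda>t. t * _"]
        if_distrib[of "\<lambda>t. _ * t"] if_distrib[of "smult _"] sum.delta cong: if_cong)
  have "?C P ** (mat [:0, 1:] - ?C W) = ?C P ** mat [:0, 1:] - ?C P ** ?C W"
    unfolding matrix_matrix_mult_def by (simp add: vec_eq_iff right_diff_distrib sum_subtractf)
  also have "\<dots> = mat [:0, 1:] ** ?C P - ?C D ** ?C P"
    unfolding X constant_matrix_mult[symmetric] assms(1) by (rule refl)
  also have "\<dots> = (mat [:0, 1:] - ?C D) ** ?C P"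
    unfolding matrix_matrix_mult_def by (simp add: vec_eq_iff left_diff_distrib smult_diff_right sum_subtractf)
  finally have "?C P ** (mat [:0, 1:] - ?C W) = (mat [:0, 1:] - ?C D) ** ?C P" .
  then have "det (?C P) * charpoly W = charpoly D * det (?C P)"
    unfolding charpoly_def det_mul[symmetric] by (rule arg_cong)
  then show ?thesis using ne by simp
qed

lemma charpoly_diagonal:
  fixes d :: "'n::finite \<Rightarrow> real"
  shows "charpoly (\<chi> i j. if i = j then d i else 0) = (\<Prod>i\<in>UNIV. [:- d i, 1:])"
  unfolding charpoly_def by (subst det_diagonal) (auto simp: mat_def)

lemma diagonalizing_frame_inverse:
  fixes G A :: "real^'n::finite^'n"
  assumes "diagonalizing_frame G A e d"
  defines "P \<equiv> (\<chi> a i. e a $ i)"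
  shows "P ** G ** transpose P = mat 1" "P ** A ** transpose P = (\<chi> i j. if i = j then d i else 0)"
    "matrix_inv G = transpose P ** P" "(G ** transpose P) ** P = mat 1"
proof -
  have *: "(P ** M ** transpose P) $ a $ c = e a \<bullet> (M *v e c)" for M a c
    unfolding matrix_mul_assoc[symmetric]
    by (simp add: P_def matrix_matrix_mult_def matrix_vector_mult_def transpose_def inner_vec_def)
  show 1: "P ** G ** transpose P = mat 1"
    using assms(1) by (simp add: vec_eq_iff * diagonalizing_frame_def mat_def)
  show "P ** A ** transpose P = (\<chi> i j. if i = j then d i else 0)"
    using assms(1) by (simp add: vec_eq_iff * diagonalizing_frame_def)
  have "(G ** transpose P) ** P = mat 1"
    using 1 by (simp add: matrix_left_right_inverse[of P] matrix_mul_assoc[symmetric])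
  then show "matrix_inv G = transpose P ** P"
    by (intro matrix_inv_eqI) (simp add: matrix_mul_assoc)
  show "(G ** transpose P) ** P = mat 1" by fact
qed

lemma diagonalizing_frame_charpoly:
  fixes G A :: "real^'n::finite^'n"
  assumes f: "diagonalizing_frame G A e d"
  shows "charpoly (A ** matrix_inv G) = (\<Prod>i\<in>UNIV. [:- d i, 1:])"
    and "trace (A ** matrix_inv G) = (\<Sum>i\<in>UNIV. d i)"
proof -
  let ?P = "\<chi> a i. e a $ i"
  note P = diagonalizing_frame_inverse[OF f]
  have "?P ** (A ** matrix_inv G) = (\<chi> i j. if i = j then d i else 0) ** ?P"
    unfolding P(3) P(2)[symmetric] by (simp add: matrix_mul_assoc)
  from charpoly_similar[OF this P(4)]
  show "charpoly (A ** matrix_inv G) = (\<Prod>i\<in>UNIV. [:- d i, 1:])"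
    by (simp add: charpoly_diagonal)
  have "trace (A ** matrix_inv G) = trace ((A ** transpose ?P) ** ?P)"
    by (simp add: P(3) matrix_mul_assoc)
  also have "\<dots> = trace (?P ** A ** transpose ?P)"
    by (subst trace_mul_sym) (simp add: matrix_mul_assoc)
  also have "\<dots> = (\<Sum>i\<in>UNIV. d i)" unfolding P(2) by (simp add: trace_def)
  finally show "trace (A ** matrix_inv G) = (\<Sum>i\<in>UNIV. d i)" .
qed

text \<open>
  The matrix \<open>A ** matrix_inv G\<close> is similar to the diagonal matrix of \<open>d\<close>. Sorting the index set by \<open>d\<close>
  turns statements on the sorted eigenvalue list into statements on the frame.
\<close>

lemma diagonalizing_frame_eigenvalue_list:
  fixes G A :: "real^'n::finite^'n"
  assumes f: "diagonalizing_frame G A e d"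
  obtains es where "distinct es" "set es = (UNIV :: 'n set)"
    "eigenvalue_list (A ** matrix_inv G) = map d es" "sorted (map d es)"
proof -
  obtain us where us: "distinct us" "set us = (UNIV :: 'n set)"
    using finite_distinct_list[of "UNIV :: 'n set"] by auto
  define es where "es = sort_key d us"
  have "proots (charpoly (A ** matrix_inv G)) = (\<Sum>i\<in>UNIV. {#d i#})"
    unfolding diagonalizing_frame_charpoly(1)[OF f] by (subst proots_prod) auto
  also have "\<dots> = mset (map d us)"
    using sum.distinct_set_conv_list[OF us(1), of "\<lambda>i. {#d i#}"] us(2) by simp
  also have "\<dots> = mset (map d es)" by (simp add: es_def)
  finally have "eigenvalue_list (A ** matrix_inv G) = sort (map d es)"
    by (simp only: eigenvalue_list_def sorted_list_of_multiset_mset)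
  moreover have "sorted (map d es)" by (simp add: es_def)
  ultimately show ?thesis
    using us by (intro that[of es]) (auto simp: es_def sorted_sort_id)
qed

text \<open>
  Contraction with a Gram matrix is a sum of squares. As the inverse metric is the Gram matrix of an
  orthonormal frame, this gives the tensor norms as sums of squared frame components; for
  3-tensors the index types are triples.
\<close>

lemma sum_gram:
  fixes c :: "'z::finite \<Rightarrow> 'x::finite \<Rightarrow> real"
  shows "(\<Sum>x\<in>UNIV. \<Sum>y\<in>UNIV. (\<Sum>z\<in>UNIV. c z x * c z y) * T x * T y)
    = (\<Sum>z\<in>UNIV. (\<Sum>x\<in>UNIV. c z x * T x)\<^sup>2)"
proof -
  have "(\<Sum>x\<in>UNIV. \<Sum>y\<in>UNIV. (\<Sum>z\<in>UNIV. c z x * c z y) * T x * T y)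
    = (\<Sum>x\<in>UNIV. \<Sum>y\<in>UNIV. \<Sum>z\<in>UNIV. (c z x * T x) * (c z y * T y))"
    by (simp add: sum_distrib_left sum_distrib_right ac_simps)
  also have "\<dots> = (\<Sum>x\<in>UNIV. \<Sum>z\<in>UNIV. \<Sum>y\<in>UNIV. (c z x * T x) * (c z y * T y))"
    by (intro sum.cong refl sum.swap)
  also have "\<dots> = (\<Sum>z\<in>UNIV. \<Sum>x\<in>UNIV. \<Sum>y\<in>UNIV. (c z x * T x) * (c z y * T y))"
    by (rule sum.swap)
  finally show ?thesis by (simp add: power2_eq_square sum_product)
qed

lemma matrix_inv_frame:
  fixes G A :: "real^'n::finite^'n"
  assumes f: "diagonalizing_frame G A e d"
  shows "matrix_inv G $ i $ j = (\<Sum>p\<in>UNIV. e p $ i * e p $ j)"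
  unfolding diagonalizing_frame_inverse(3)[OF f]
  by (simp add: matrix_matrix_mult_def transpose_def)

lemma tensor1_norm_sq_frame:
  fixes G A :: "real^'n::finite^'n"
  assumes f: "diagonalizing_frame G A e d"
  shows "tensor1_norm_sq G T = (\<Sum>p\<in>UNIV. (\<Sum>i\<in>UNIV. e p $ i * T i)\<^sup>2)"
  unfolding tensor1_norm_sq_def matrix_inv_frame[OF f] by (rule sum_gram)

lemma sum_UNIV_triple:
  "(\<Sum>x\<in>UNIV. f x) = (\<Sum>i\<in>UNIV. \<Sum>k\<in>UNIV. \<Sum>l\<in>UNIV. f (i::'a::finite, k::'b::finite, l::'c::finite))"
  by (simp add: sum.cartesian_product UNIV_Times_UNIV[symmetric] del: UNIV_Times_UNIV)

lemma tensor3_norm_sq_frame: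
  fixes G A :: "real^'n::finite^'n"
  assumes f: "diagonalizing_frame G A e d"
  shows "tensor3_norm_sq G T = (\<Sum>p\<in>UNIV. \<Sum>q\<in>UNIV. \<Sum>r\<in>UNIV.
    (\<Sum>i\<in>UNIV. \<Sum>k\<in>UNIV. \<Sum>l\<in>UNIV. e p $ i * e q $ k * e r $ l * T i k l)\<^sup>2)"
proof -
  let ?c = "\<lambda>(p, q, r) (i, k, l). e p $ i * e q $ k * e r $ l"
  let ?T = "\<lambda>(i, k, l). T i k l"
  have prod: "(\<Sum>p\<in>UNIV. \<Sum>q\<in>UNIV. \<Sum>r\<in>UNIV. f p * f' q * f'' r)
      = sum f UNIV * sum f' UNIV * sum f'' UNIV" for f f' f'' :: "'n \<Rightarrow> real"
    by (simp add: sum_distrib_left[symmetric] sum_distrib_right[symmetric])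
  have "(\<Sum>z\<in>UNIV. ?c z (i, k, l) * ?c z (a, b, c))
      = matrix_inv G $ i $ a * matrix_inv G $ k $ b * matrix_inv G $ l $ c" for i k l a b c
    unfolding matrix_inv_frame[OF f] sum_UNIV_triple prod[symmetric]
    by (simp add: ac_simps)
  then have "tensor3_norm_sq G T
      = (\<Sum>x\<in>UNIV. \<Sum>y\<in>UNIV. (\<Sum>z\<in>UNIV. ?c z x * ?c z y) * ?T x * ?T y)"
    unfolding tensor3_norm_sq_def sum_UNIV_triple by simp
  also have "\<dots> = (\<Sum>z\<in>UNIV. (\<Sum>x\<in>UNIV. ?c z x * ?T x)\<^sup>2)"
    by (rule sum_gram)
  finally show ?thesis unfolding sum_UNIV_triple by simp
qed

section \<open>Algebraic estimates\<close>

text \<open>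
  Since \<open>B\<close> is symmetric in its first two indices, it drops out of the difference of the components
  \<open>(q, p, q)\<close> and \<open>(p, q, q)\<close> for \<open>p \<noteq> q\<close>, which is \<open>t p * d q\<close>. Hence the squares of these two components
  add up to at least \<open>(t p)\<^sup>2 (d q)\<^sup>2 / 2\<close>. All the triples involved are distinct, so one may choose for
  every \<open>p\<close> one \<open>q\<close> with \<open>d q \<ge> c\<close> and sum over \<open>p\<close>.
\<close>

lemma codazzi_gradient_bound:
  fixes B :: "'n::finite \<Rightarrow> 'n \<Rightarrow> 'n \<Rightarrow> real" and t d :: "'n \<Rightarrow> real"
  assumes sym: "\<And>p q r. B p q r = B q p r" and c: "0 \<le> c"
    and large: "\<And>p. \<exists>q. q \<noteq> p \<and> c \<le> d q"
  shows "c\<^sup>2 / 2 * (\<Sum>p\<in>UNIV. (t p)\<^sup>2)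
    \<le> (\<Sum>p\<in>UNIV. \<Sum>q\<in>UNIV. \<Sum>r\<in>UNIV. (B p q r - t p * (if q = r then d q else 0))\<^sup>2)"
proof -
  define E where "E p q r = B p q r - t p * (if q = r then d q else 0)" for p q r
  define u where "u p q = (if p \<noteq> q then (E p q q)\<^sup>2 else 0)" for p q
  define v where "v p q = (if p \<noteq> q then (E q p q)\<^sup>2 else 0)" for p q
  have "c\<^sup>2 / 2 * (t p)\<^sup>2 \<le> (\<Sum>q\<in>UNIV. u p q + v p q)" for p
  proof -
    obtain q where q: "q \<noteq> p" "c \<le> d q" using large by blast
    have "E q p q - E p q q = t p * d q"
      using q sym[of p q q] by (simp add: E_def)
    then have "(t p * d q)\<^sup>2 = (E q p q - E p q q)\<^sup>2" by simp
    also have "\<dots> \<le> 2 * ((E p q q)\<^sup>2 + (E q p q)\<^sup>2)"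
      using zero_le_power2[of "E q p q + E p q q"] by (simp add: power2_eq_square algebra_simps)
    finally have "(t p)\<^sup>2 * (d q)\<^sup>2 \<le> 2 * (u p q + v p q)"
      using q by (simp add: u_def v_def power_mult_distrib)
    moreover have "(t p)\<^sup>2 * c\<^sup>2 \<le> (t p)\<^sup>2 * (d q)\<^sup>2"
      using q c by (intro mult_left_mono power_mono) auto
    moreover have "u p q + v p q \<le> (\<Sum>q\<in>UNIV. u p q + v p q)"
      by (rule member_le_sum) (auto simp: u_def v_def)
    ultimately show ?thesis by (simp add: mult.commute)
  qed
  then have "c\<^sup>2 / 2 * (\<Sum>p\<in>UNIV. (t p)\<^sup>2) \<le> (\<Sum>p\<in>UNIV. \<Sum>q\<in>UNIV. u p q + v p q)"
    unfolding sum_distrib_left by (intro sum_mono)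
  also have "\<dots> = (\<Sum>p\<in>UNIV. \<Sum>q\<in>UNIV. u p q) + (\<Sum>p\<in>UNIV. \<Sum>q\<in>UNIV. v p q)"
    by (simp add: sum.distrib)
  also have "(\<Sum>p\<in>UNIV. \<Sum>q\<in>UNIV. v p q) = (\<Sum>p\<in>UNIV. \<Sum>q\<in>UNIV. v q p)"
    by (rule sum.swap)
  also have "(\<Sum>p\<in>UNIV. \<Sum>q\<in>UNIV. u p q) + (\<Sum>p\<in>UNIV. \<Sum>q\<in>UNIV. v q p)
      = (\<Sum>p\<in>UNIV. \<Sum>q\<in>UNIV. u p q + v q p)"
    by (simp add: sum.distrib)
  also have "\<dots> \<le> (\<Sum>p\<in>UNIV. \<Sum>q\<in>UNIV. \<Sum>r\<in>UNIV. (E p q r)\<^sup>2)"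
  proof (intro sum_mono)
    fix p q
    show "u p q + v q p \<le> (\<Sum>r\<in>UNIV. (E p q r)\<^sup>2)"
    proof (cases "p = q")
      case False
      then have "u p q + v q p = (\<Sum>r\<in>{p, q}. (E p q r)\<^sup>2)"
        by (simp add: u_def v_def)
      also have "\<dots> \<le> (\<Sum>r\<in>UNIV. (E p q r)\<^sup>2)"
        by (rule sum_mono2) auto
      finally show ?thesis .
    qed (simp add: u_def v_def sum_nonneg)
  qed
  finally show ?thesis by (simp add: E_def)
qed

text \<open>
  For \<open>\<tau>\<close> between \<open>0\<close> and \<open>2\<close> the form interpolates between \<open>a\<^sup>2 + b\<^sup>2\<close> and \<open>(a + b)\<^sup>2\<close>.
\<close>

lemma quadratic_form_nonneg:
  fixes a b \<tau> :: real
  assumes "0 \<le> \<tau>" "\<tau> \<le> 2"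
  shows "0 \<le> a\<^sup>2 + b\<^sup>2 + \<tau> * a * b"
proof -
  have "a\<^sup>2 + b\<^sup>2 + \<tau> * a * b = (1 - \<tau> / 2) * (a\<^sup>2 + b\<^sup>2) + \<tau> / 2 * (a + b)\<^sup>2"
    by (simp add: power2_eq_square field_simps)
  also have "\<dots> \<ge> 0" using assms by simp
  finally show ?thesis by simp
qed

text \<open>
  Write \<open>s = l 1 + l 2\<close>. In \<open>P_tau\<close> everything but \<open>H s\<close> is nonpositive, so the pinching condition for
  the pair \<open>(1, 2)\<close> gives \<open>\<alpha> (l n - l 1) \<le> s\<close>. As \<open>l 1 \<le> s / 2\<close>, this yields \<open>l n \<le> s / 2 + s / \<alpha>\<close>,
  and \<open>H \<le> s + (n - 2) l n\<close> then bounds \<open>H\<close> by a multiple of \<open>s\<close>.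
\<close>

lemma two_smallest_bound:
  fixes l :: "nat \<Rightarrow> real"
  assumes n: "n \<ge> 3" and mono: "mono_on {1..n} l"
    and H: "H = (\<Sum>i=1..n. l i)" "H > 0" and \<tau>: "0 \<le> \<tau>" "\<tau> \<le> 2" and \<alpha>: "\<alpha> > 0"
    and P: "P_tau n \<kappa> \<tau> H l 1 2 \<ge> \<alpha> * H * \<bar>l n - l 1\<bar>"
  shows "l 1 + l 2 \<ge> 2 * \<alpha> / (2 * (real n - 2) + real n * \<alpha>) * H"
proof -
  let ?s = "l 1 + l 2"
  have "(2 * (real n - 1) - \<tau>) * \<kappa>\<^sup>2 \<ge> 0" using n \<tau> by (intro mult_nonneg_nonneg) auto
  then have "P_tau n \<kappa> \<tau> H l 1 2 \<le> H * ?s"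
    using quadratic_form_nonneg[OF \<tau>, of "l 1" "l 2"] by (simp add: P_tau_def)
  then have "H * (\<alpha> * \<bar>l n - l 1\<bar>) \<le> H * ?s" using P by (simp add: ac_simps)
  then have "\<alpha> * \<bar>l n - l 1\<bar> \<le> ?s" using H(2) by simp
  moreover have "\<alpha> * (l n - l 1) \<le> \<alpha> * \<bar>l n - l 1\<bar>" using \<alpha> by (intro mult_left_mono) auto
  ultimately have s: "\<alpha> * l n \<le> ?s + \<alpha> * l 1" by (simp add: algebra_simps)
  have "l 1 \<le> l 2" using n by (intro mono_onD[OF mono]) auto
  then have "\<alpha> * (2 * l 1) \<le> \<alpha> * ?s" using \<alpha> by (intro mult_left_mono) auto
  with s have ln: "2 * \<alpha> * l n \<le> (2 + \<alpha>) * ?s" by (simp add: algebra_simps)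
  have "H = ?s + (\<Sum>i=3..n. l i)"
    using n unfolding H by (simp add: sum.atLeast_Suc_atMost numeral_eq_Suc)
  also have "(\<Sum>i=3..n. l i) \<le> (\<Sum>i=3..n. l n)"
    by (intro sum_mono mono_onD[OF mono]) auto
  also have "\<dots> = (real n - 2) * l n" using n by (simp add: of_nat_diff)
  finally have "2 * \<alpha> * H \<le> 2 * \<alpha> * (?s + (real n - 2) * l n)" using \<alpha> by simp
  also have "\<dots> = 2 * \<alpha> * ?s + (real n - 2) * (2 * \<alpha> * l n)" by (simp add: algebra_simps)
  also have "\<dots> \<le> 2 * \<alpha> * ?s + (real n - 2) * ((2 + \<alpha>) * ?s)"
    using n ln by (intro add_left_mono mult_left_mono) auto
  also have "\<dots> = (2 * (real n - 2) + real n * \<alpha>) * ?s" by (simp add: algebra_simps)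
  finally show ?thesis
  proof -
    assume le: "2 * \<alpha> * H \<le> (2 * (real n - 2) + real n * \<alpha>) * ?s"
    have "2 * (real n - 2) + real n * \<alpha> > 0" using n \<alpha> by (intro add_pos_pos) auto
    then show ?thesis using le by (simp add: pos_divide_le_eq mult.commute)
  qed
qed

text \<open>
  If the two smallest values have a nonnegative sum, then at most the first value is negative, and
  it is compensated by the second. This bounds all of them by the total \<open>H\<close>.
\<close>

lemma eigenvalue_bounds:
  fixes l :: "nat \<Rightarrow> real"
  assumes n: "n \<ge> 3" and mono: "mono_on {1..n} l" and H: "H = (\<Sum>i=1..n. l i)" and s: "l 1 + l 2 \<ge> 0"
  shows "- H \<le> l 1" "l n \<le> H" "H\<^sup>2 / real n \<le> (\<Sum>i=1..n. (l i)\<^sup>2)" "(\<Sum>i=1..n. (l i)\<^sup>2) \<le> real n * H\<^sup>2"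
proof -
  have l12: "l 1 \<le> l 2" using n by (intro mono_onD[OF mono]) auto
  have nonneg: "l i \<ge> 0" if "i \<in> {2..n}" for i
  proof -
    have "l 2 \<le> l i" using that by (intro mono_onD[OF mono]) auto
    then show ?thesis using l12 s by linarith
  qed
  have split: "H = l 1 + l 2 + (\<Sum>i=3..n. l i)"
    using n unfolding H by (simp add: sum.atLeast_Suc_atMost numeral_eq_Suc)
  have rest: "l n \<le> (\<Sum>i=3..n. l i)"
    using n nonneg by (intro member_le_sum) auto
  then show ln: "l n \<le> H" using split s by linarith
  have "l 2 \<le> l n" using n by (intro mono_onD[OF mono]) auto
  then show l1: "- H \<le> l 1" using s ln by linarith
  have "\<bar>l i\<bar> \<le> H" if "i \<in> {1..n}" for i
  proof -
    have "l 1 \<le> l i" "l i \<le> l n" using that by (auto intro!: mono_onD[OF mono])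
    then show ?thesis using l1 ln by linarith
  qed
  then have "(l i)\<^sup>2 \<le> H\<^sup>2" if "i \<in> {1..n}" for i
    using that by (metis abs_ge_zero power2_abs power_mono)
  then have "(\<Sum>i=1..n. (l i)\<^sup>2) \<le> (\<Sum>i=1..n. H\<^sup>2)" by (intro sum_mono)
  then show "(\<Sum>i=1..n. (l i)\<^sup>2) \<le> real n * H\<^sup>2" by simp
  have "H\<^sup>2 \<le> real n * (\<Sum>i=1..n. (l i)\<^sup>2)"
    using sum_squared_le_sum_of_squares[of l "{1..n}"] by (simp add: H mult.commute)
  then show "H\<^sup>2 / real n \<le> (\<Sum>i=1..n. (l i)\<^sup>2)"
    using n by (simp add: divide_le_eq mult.commute)
qed

section \<open>Hypersurfaces in the curvature class\<close>

lemma sum_nth_pred: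
  assumes "length xs = n" shows "(\<Sum>i=1..n. f (xs ! (i - 1))) = sum_list (map f xs)"
  using assms by (simp add: sum.atLeast1_atMost_eq sum_list_sum_nth atLeast0LessThan)

context sf_patch
begin

lemma principal_frame:
  assumes x: "x \<in> S"
  obtains e d es where "diagonalizing_frame (g x) (h x) e d" "distinct es" "set es = (UNIV :: 'n set)"
    "length es = CARD('n)" "sorted (map d es)"
    "\<And>i. i \<in> {1..CARD('n)} \<Longrightarrow> pcurv (sf_metric \<kappa>) F N x i = d (es ! (i - 1))"
    "mean_curv (sf_metric \<kappa>) F N x = (\<Sum>i=1..CARD('n). pcurv (sf_metric \<kappa>) F N x i)"
proof -
  obtain e d where f: "diagonalizing_frame (g x) (h x) e d"
    using diagonalizing_frame_exists[of "g x" "h x"] induced_metric_symmetric[of x]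
      induced_metric_pos[OF x] second_ff_symmetric[OF x] by blast
  obtain es where es: "distinct es" "set es = (UNIV :: 'n set)"
    "eigenvalue_list (h x ** ginv x) = map d es" "sorted (map d es)"
    by (rule diagonalizing_frame_eigenvalue_list[OF f])
  have len: "length es = CARD('n)" using es(1,2) distinct_card by metis
  have l: "pcurv (sf_metric \<kappa>) F N x i = d (es ! (i - 1))" if "i \<in> {1..CARD('n)}" for i
  proof -
    have "i - 1 < length es" using that len by auto
    then show ?thesis by (simp add: pcurv_def weingarten_def es(3))
  qed
  have "mean_curv (sf_metric \<kappa>) F N x = (\<Sum>i\<in>UNIV. d i)"
    by (simp add: mean_curv_def weingarten_def diagonalizing_frame_charpoly(2)[OF f])
  also have "\<dots> = sum_list (map d es)"
    using sum.distinct_set_conv_list[OF es(1), of d] es(2) by simp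
  also have "\<dots> = (\<Sum>i=1..CARD('n). d (es ! (i - 1)))"
    by (rule sum_nth_pred[OF len, symmetric])
  also have "\<dots> = (\<Sum>i=1..CARD('n). pcurv (sf_metric \<kappa>) F N x i)"
    using l by (intro sum.cong) auto
  finally show ?thesis using that[OF f es(1,2) len es(4) l] by blast
qed

text \<open>
  In a frame of principal directions the Codazzi equation makes the components of \<open>H \<nabla>h\<close> symmetric in
  the first two indices, while those of \<open>h\<close> are diagonal.
\<close>

lemma gradient_bound:
  fixes t :: "'n \<Rightarrow> real"
  assumes x: "x \<in> S" and f: "diagonalizing_frame (g x) (h x) e d" and c: "0 \<le> c"
    and large: "\<And>p. \<exists>q. q \<noteq> p \<and> c \<le> d q"
  shows "c\<^sup>2 / 2 * tensor1_norm_sq (g x) t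
    \<le> tensor3_norm_sq (g x) (\<lambda>i k m. H * nabla_h (sf_metric \<kappa>) F N x i k m - t i * h x $ k $ m)"
proof -
  let ?T = "nabla_h (sf_metric \<kappa>) F N x"
  define B where "B p q r = H * (\<Sum>i\<in>UNIV. \<Sum>k\<in>UNIV. \<Sum>l\<in>UNIV. e p $ i * e q $ k * e r $ l * ?T i k l)"
    for p q r
  define t' where "t' p = (\<Sum>i\<in>UNIV. e p $ i * t i)" for p
  have "B p q r = B q p r" for p q r
  proof -
    have "(\<Sum>i\<in>UNIV. \<Sum>k\<in>UNIV. \<Sum>l\<in>UNIV. e p $ i * e q $ k * e r $ l * ?T i k l)
        = (\<Sum>k\<in>UNIV. \<Sum>i\<in>UNIV. \<Sum>l\<in>UNIV. e p $ i * e q $ k * e r $ l * ?T i k l)"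
      by (rule sum.swap)
    also have "\<dots> = (\<Sum>k\<in>UNIV. \<Sum>i\<in>UNIV. \<Sum>l\<in>UNIV. e q $ k * e p $ i * e r $ l * ?T k i l)"
      by (intro sum.cong refl) (simp add: codazzi[OF x])
    finally show ?thesis by (simp add: B_def)
  qed
  from codazzi_gradient_bound[of B, OF this c large, of t']
  have "c\<^sup>2 / 2 * (\<Sum>p\<in>UNIV. (t' p)\<^sup>2)
    \<le> (\<Sum>p\<in>UNIV. \<Sum>q\<in>UNIV. \<Sum>r\<in>UNIV. (B p q r - t' p * (if q = r then d q else 0))\<^sup>2)" .
  moreover have "(\<Sum>i\<in>UNIV. \<Sum>k\<in>UNIV. \<Sum>l\<in>UNIV. e p $ i * e q $ k * e r $ l * (H * ?T i k l - t i * h x $ k $ l))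
      = B p q r - t' p * (if q = r then d q else 0)" for p q r
  proof -
    have "(\<Sum>k\<in>UNIV. \<Sum>l\<in>UNIV. e q $ k * e r $ l * h x $ k $ l) = e q \<bullet> (h x *v e r)"
      by (simp add: inner_vec_def matrix_vector_mult_def sum_distrib_left ac_simps)
    also have "\<dots> = (if q = r then d q else 0)" using f by (simp add: diagonalizing_frame_def)
    finally have "t' p * (if q = r then d q else 0)
        = (\<Sum>i\<in>UNIV. e p $ i * t i) * (\<Sum>k\<in>UNIV. \<Sum>l\<in>UNIV. e q $ k * e r $ l * h x $ k $ l)"
      by (simp add: t'_def)
    also have "\<dots> = (\<Sum>i\<in>UNIV. \<Sum>k\<in>UNIV. \<Sum>l\<in>UNIV. e p $ i * e q $ k * e r $ l * (t i * h x $ k $ l))"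
      unfolding sum_distrib_right unfolding sum_distrib_left by (simp add: ac_simps)
    finally show ?thesis
      by (simp add: B_def sum_distrib_left sum_subtractf right_diff_distrib ac_simps)
  qed
  ultimately show ?thesis
    unfolding tensor1_norm_sq_frame[OF f] tensor3_norm_sq_frame[OF f] t'_def by simp
qed

end

lemma sf_patch_of_chart:
  assumes M: "closed_manifold M \<A>" and X: "two_sided_immersion (sf_domain \<kappa>) (sf_metric \<kappa>) M \<A> X \<nu>"
    and c: "c \<in> \<A>"
  shows "sf_patch \<kappa> (chart_range c) (in_chart c X) (in_chart c \<nu>)"
proof
  fix x assume x: "x \<in> chart_range c"
  have "inv_into (fst c) (snd c) x \<in> fst c"
    using x by (simp add: chart_range_def inv_into_into)
  also have "fst c \<subseteq> topspace M" using M c by (auto simp: closed_manifold_def)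
  finally show "in_chart c X x \<in> sf_domain \<kappa>"
    using X by (auto simp: in_chart_def two_sided_immersion_def)
qed (use M X c in \<open>auto simp: closed_manifold_def two_sided_immersion_def\<close>)

theorem proposition2p6:
  fixes \<alpha>\<^sub>0 \<beta> :: real and n :: nat
  assumes "n = CARD('n::finite)" and "n \<ge> 3" and "\<alpha>\<^sub>0 > 0"
    and "\<beta> = 2 * \<alpha>\<^sub>0 / (2 * (real n - 2) + real n * \<alpha>\<^sub>0)"
  shows "\<beta> > 0 \<and>
    (\<forall>\<kappa> \<tau> R \<alpha>\<^sub>1 \<alpha>\<^sub>2 (M :: 'm topology) (\<A> :: ('m, 'n) chart set)
       (X :: 'm \<Rightarrow> real^'k::finite) (\<nu> :: 'm \<Rightarrow> real^'k).
       0 \<le> \<kappa> \<and> \<kappa> \<le> 1 \<and> \<tau> \<in> tau_range n \<and> 0 < R \<and> R \<le> 1 \<and> \<alpha>\<^sub>1 > 0 \<and> \<alpha>\<^sub>2 > 0 \<and>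
       curvature_class \<tau> \<kappa> R \<alpha>\<^sub>0 \<alpha>\<^sub>1 \<alpha>\<^sub>2 M \<A> X \<nu> \<longrightarrow>
       (\<forall>c\<in>\<A>. \<forall>x\<in>chart_range c.
          let G = sf_metric \<kappa>; F = in_chart c X; N = in_chart c \<nu>;
              g = induced_metric G F x;
              h = second_ff G F N x;
              H = mean_curv G F N x;
              dH = (\<lambda>i. pd i (mean_curv G F N) x);
              l = pcurv G F N x
          in l 1 + l 2 \<ge> \<beta> * H \<and>
             - H \<le> l 1 \<and> (\<forall>i\<in>{1..<n}. l i \<le> l (i + 1)) \<and> l n \<le> H \<and>
             H\<^sup>2 / real n \<le> normA_sq G F N x \<and> normA_sq G F N x \<le> real n * H\<^sup>2 \<and>
             (\<forall>i\<in>{2..n}. l i \<ge> \<beta> * H / 2) \<and>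
             tensor3_norm_sq g (\<lambda>i k m. H * nabla_h G F N x i k m - dH i * h $ k $ m)
               \<ge> \<beta>\<^sup>2 / 8 * H\<^sup>2 * tensor1_norm_sq g dH))"
proof (intro conjI allI impI ballI)
  have "2 * (real n - 2) + real n * \<alpha>\<^sub>0 > 0" using assms by (intro add_pos_pos) auto
  then show \<beta>: "\<beta> > 0" using assms(3,4) by simp
  fix \<kappa> \<tau> R \<alpha>\<^sub>1 \<alpha>\<^sub>2 :: real and M :: "'m topology" and \<A> :: "('m, 'n) chart set"
    and X \<nu> :: "'m \<Rightarrow> real^'k" and c x
  assume *: "0 \<le> \<kappa> \<and> \<kappa> \<le> 1 \<and> \<tau> \<in> tau_range n \<and> 0 < R \<and> R \<le> 1 \<and> \<alpha>\<^sub>1 > 0 \<and> \<alpha>\<^sub>2 > 0 \<and>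
       curvature_class \<tau> \<kappa> R \<alpha>\<^sub>0 \<alpha>\<^sub>1 \<alpha>\<^sub>2 M \<A> X \<nu>"
    and c: "c \<in> \<A>" and x: "x \<in> chart_range c"
  let ?G = "sf_metric \<kappa> :: real^'k \<Rightarrow> real^'k^'k"
  let ?F = "in_chart c X" and ?N = "in_chart c \<nu>"
  define H where "H = mean_curv ?G ?F ?N x"
  define l where "l = pcurv ?G ?F ?N x"
  interpret sf_patch \<kappa> "chart_range c" ?F ?N
    using * c by (intro sf_patch_of_chart[of M \<A>]) (auto simp: curvature_class_def)
  have P: "P_tau n \<kappa> \<tau> H l i j \<ge> \<alpha>\<^sub>0 * H * \<bar>l p - l q\<bar>"
    if "i \<in> {1..n}" "j \<in> {1..n}" "i \<noteq> j" "p \<in> {1..n}" "q \<in> {1..n}" for i j p q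
    using * c x that unfolding curvature_class_def Let_def H_def l_def assms(1) by blast
  have "H - real n * \<kappa> \<ge> \<alpha>\<^sub>2 / R"
    using * c x unfolding curvature_class_def Let_def H_def assms(1) by blast
  moreover have "\<alpha>\<^sub>2 / R > 0" "real n * \<kappa> \<ge> 0" using * by auto
  ultimately have Hpos: "H > 0" by linarith
  have \<tau>: "0 \<le> \<tau>" "\<tau> \<le> 2" using * by (auto simp: tau_range_def split: if_splits)
  obtain e d es where f: "diagonalizing_frame (g x) (h x) e d"
    and es: "distinct es" "set es = (UNIV :: 'n set)" "length es = n" "sorted (map d es)"
    and l: "\<And>i. i \<in> {1..n} \<Longrightarrow> l i = d (es ! (i - 1))" and H: "H = (\<Sum>i=1..n. l i)"
    using principal_frame[OF x] unfolding assms(1) l_def H_def by metis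
  have mono: "mono_on {1..n} l"
  proof (rule mono_onI)
    fix i j assume ij: "i \<in> {1..n}" "j \<in> {1..n}" "i \<le> j"
    then have "map d es ! (i - 1) \<le> map d es ! (j - 1)"
      using es(3) by (intro sorted_nth_mono[OF es(4)]) auto
    then show "l i \<le> l j" using ij es(3) by (simp add: l)
  qed
  have s: "l 1 + l 2 \<ge> \<beta> * H"
    unfolding assms(4)
    by (rule two_smallest_bound[OF assms(2) mono H Hpos \<tau> assms(3)], rule P) (use assms(2) in auto)
  moreover have "\<beta> * H > 0" using \<beta> Hpos by simp
  ultimately have s0: "l 1 + l 2 \<ge> 0" by linarith
  note bounds = eigenvalue_bounds[OF assms(2) mono H s0]
  have A: "normA_sq ?G ?F ?N x = (\<Sum>i=1..n. (l i)\<^sup>2)"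
    by (simp add: normA_sq_def l_def assms(1))
  have step: "l i \<le> l (i + 1)" if "i \<in> {1..<n}" for i
    using that by (intro mono_onD[OF mono]) auto
  have large: "l i \<ge> \<beta> * H / 2" if "i \<in> {2..n}" for i
  proof -
    have "l 1 \<le> l 2" "l 2 \<le> l i" using that by (auto intro!: mono_onD[OF mono])
    then show ?thesis using s by linarith
  qed
  \<comment> \<open>only \<open>l 1\<close> can be small, and of the directions of \<open>l 2\<close> and \<open>l 3\<close> one differs from \<open>p\<close>\<close>
  have "\<exists>q. q \<noteq> p \<and> \<beta> * H / 2 \<le> d q" for p
  proof -
    have "es ! 1 \<noteq> es ! 2" using es(1,3) assms(2) by (simp add: nth_eq_iff_index_eq)
    moreover have "\<beta> * H / 2 \<le> d (es ! 1)" "\<beta> * H / 2 \<le> d (es ! 2)"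
      using large[of 2] large[of 3] l[of 2] l[of 3] assms(2) by auto
    ultimately show ?thesis by metis
  qed
  from gradient_bound[OF x f _ this, of "\<lambda>i. pd i (mean_curv ?G ?F ?N) x" H]
  have "\<beta>\<^sup>2 / 8 * H\<^sup>2 * tensor1_norm_sq (g x) (\<lambda>i. pd i (mean_curv ?G ?F ?N) x)
    \<le> tensor3_norm_sq (g x)
        (\<lambda>i k m. H * nabla_h ?G ?F ?N x i k m - pd i (mean_curv ?G ?F ?N) x * h x $ k $ m)"
    using \<open>\<beta> * H > 0\<close> by (simp add: power_divide power_mult_distrib)
  then show "let G = sf_metric \<kappa>; F = in_chart c X; N = in_chart c \<nu>;
              g = induced_metric G F x;
              h = second_ff G F N x;
              H = mean_curv G F N x;
              dH = (\<lambda>i. pd i (mean_curv G F N) x);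
              l = pcurv G F N x
          in l 1 + l 2 \<ge> \<beta> * H \<and>
             - H \<le> l 1 \<and> (\<forall>i\<in>{1..<n}. l i \<le> l (i + 1)) \<and> l n \<le> H \<and>
             H\<^sup>2 / real n \<le> normA_sq G F N x \<and> normA_sq G F N x \<le> real n * H\<^sup>2 \<and>
             (\<forall>i\<in>{2..n}. l i \<ge> \<beta> * H / 2) \<and>
             tensor3_norm_sq g (\<lambda>i k m. H * nabla_h G F N x i k m - dH i * h $ k $ m)
               \<ge> \<beta>\<^sup>2 / 8 * H\<^sup>2 * tensor1_norm_sq g dH"
    unfolding Let_def H_def[symmetric] l_def[symmetric] A
    using s bounds step large by blast
qed

end
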